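(* Let $a_0>0$ and $\tilde a_0\ge 10$ be constants and let $\xi=\xi_N$ be a sequence of parameters with $1+a_0\le \xi_N\le \tilde a_0\log\log N$. Then there exists a constant $C>0$, not depending on $N$, such that for every $p=p(N)\in[0,1]$ with $$\frac{(\log N)^{2C\xi_N}}{Np}\to 0\quad\text{as } N\to\infty,$$ the following holds for the Erdős–Rényi random graph $G(N,p)$ on vertex set $V$, $|V|=N$: for each vertex $j\in V$ (possibly depending on $N$), asymptotically almost surely $$H_j=N(1+o(1)),$$ where $H_j=\sum_{i\in V}\pi_i h_{ij}$ is the random target time of the simple random walk on the graph.
   Context: $G(N,p)$ is the random graph on $N$ vertices in which each edge is present independently with probability $p=p(N)\in[0,1]$; $\mathbb{P}_p$ is its law, and $(V,\mathcal{E})$ denotes a realization. An event $A_N$ holds asymptotically almost surely (a.a.s.) if $\mathbb{P}_p(A_N)\to1$ as $N\to\infty$. A statement "a.a.s. $X_N=N(1+o(1))$" means that there is a deterministic sequence $\varepsilon_N\to0$ such that $\mathbb{P}_p(|X_N/N-1|\le\varepsilon_N)\to1$. For a connected realization $(V,\mathcal{E})$, $d_i$ is the degree of vertex $i$, $|\mathcal{E}|$ is the number of edges, and $(X_n)_{n\in\mathbb{N}}$ is the simple random walk on $(V,\mathcal{E})$, i.e. the Markov chain on $V$ with transition probabilities $p_{ij}=1/d_i$ if $ij\in\mathcal{E}$ and $0$ otherwise. Its stationary distribution is $\pi_i=d_i/(2|\mathcal{E}|)$. The hitting time is $h_{ij}=\mathbb{E}_i(\tau_j)$, where $\tau_j=\inf\{m>0: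 X_m=j\}$ and $\mathbb{E}_i$ is the expectation for the walk started at $X_0=i$ (with the graph fixed). The quantities $h_{ij}$ and $H_j$ are random through the graph; they are considered when the graph is connected, and the a.a.s. assertion includes that the graph is connected. *)

theory Defs
  imports "HOL-Probability.Probability"
begin

text \<open>
  A simple graph is given by a vertex set and a set \<open>E\<close> of two-element subsets of it.
\<close>

definition possible_edges :: "nat \<Rightarrow> nat set set" where
  "possible_edges N = {e. e \<subseteq> {..<N} \<and> card e = 2}"

definition gnp :: "nat \<Rightarrow> real \<Rightarrow> nat set set pmf" where
  "gnp N p =
     map_pmf (\<lambda>present. {e \<in> possible_edges N. present e})
       (Pi_pmf (possible_edges N) False (\<lambda>_. bernoulli_pmf p))"

definition aas :: "(nat \<Rightarrow> real) \<Rightarrow> (nat \<Rightarrow> nat set set \<Rightarrow> bool) \<Rightarrow> bool" where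
  "aas p A \<longleftrightarrow> (\<lambda>N. measure_pmf.prob (gnp N (p N)) {E. A N E}) \<longlonglongrightarrow> 1"

definition graph_connected :: "'a set \<Rightarrow> 'a set set \<Rightarrow> bool" where
  "graph_connected V E \<longleftrightarrow> (\<forall>u\<in>V. \<forall>v\<in>V. (u, v) \<in> {(x, y). {x, y} \<in> E}\<^sup>*)"

definition neighbours :: "'a set set \<Rightarrow> 'a \<Rightarrow> 'a set" where
  "neighbours E u = {v. {u, v} \<in> E}"

definition degree :: "'a set set \<Rightarrow> 'a \<Rightarrow> nat" where
  "degree E u = card (neighbours E u)"

text \<open>
  The simple random walk started at \<open>i\<close> is the coordinate process on \<open>nat \<Rightarrow> 'a\<close> under the
  Ionescu-Tulcea measure of the kernels below: the coordinate at time 0 is \<open>i\<close>, and given the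
  coordinates up to time \<open>n\<close>, the next one is a uniformly chosen neighbour of the current one.
  At an isolated vertex \<open>pmf_of_set {}\<close> is an unspecified distribution; this case does not
  arise for a connected graph on at least two vertices.
\<close>

definition srw_kernel :: "'a set set \<Rightarrow> 'a \<Rightarrow> nat \<Rightarrow> (nat \<Rightarrow> 'a) \<Rightarrow> 'a measure" where
  "srw_kernel E i n \<omega> =
     (case n of
        0 \<Rightarrow> return (count_space UNIV) i
      | Suc m \<Rightarrow> measure_pmf (pmf_of_set (neighbours E (\<omega> m))))"

interpretation SRW: Ionescu_Tulcea "srw_kernel E i" "\<lambda>_. count_space UNIV"
  for E :: "'a set set" and i :: 'a
proof (rule Ionescu_Tulcea.intro)
  fix n
  show "srw_kernel E i n \<in>
      measurable (PiM {0..<n} (\<lambda>_. count_space UNIV)) (subprob_algebra (count_space UNIV))"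
  proof (cases n)
    case 0
    then show ?thesis
      by (auto simp: srw_kernel_def[abs_def] space_subprob_algebra subprob_space_return
          intro!: measurable_const)
  next
    case (Suc m)
    have "(\<lambda>\<omega>. \<omega> m) \<in> measurable (PiM {0..<n} (\<lambda>_. count_space UNIV :: 'a measure)) (count_space UNIV)"
      using Suc by (intro measurable_component_singleton) auto
    moreover have "(\<lambda>u. measure_pmf (pmf_of_set (neighbours E u))) \<in>
        measurable (count_space UNIV) (subprob_algebra (count_space UNIV))"
      by (simp add: space_subprob_algebra measure_pmf.subprob_space_axioms)
    ultimately show ?thesis
      using Suc by (simp add: srw_kernel_def[abs_def] measurable_compose)
  qed
next
  fix n and \<omega> :: "nat \<Rightarrow> 'a"
  show "prob_space (srw_kernel E i n \<omega>)"
    by (auto simp: srw_kernel_def prob_space_return measure_pmf.prob_space_axioms split: nat.split)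
qed

definition srw :: "'a set set \<Rightarrow> 'a \<Rightarrow> (nat \<Rightarrow> 'a) measure" where
  "srw E i = SRW.PF.lim E i"

definition hit :: "'a \<Rightarrow> (nat \<Rightarrow> 'a) \<Rightarrow> ennreal" where
  "hit j X = (INF m\<in>{m. 0 < m \<and> X m = j}. of_nat m)"

definition hitting_time :: "'a set set \<Rightarrow> 'a \<Rightarrow> 'a \<Rightarrow> ennreal" where
  "hitting_time E i j = (\<integral>\<^sup>+ X. hit j X \<partial>srw E i)"

definition stationary :: "'a set set \<Rightarrow> 'a \<Rightarrow> real" where
  "stationary E i = real (degree E i) / (2 * real (card E))"

definition target_time :: "'a set \<Rightarrow> 'a set set \<Rightarrow> 'a \<Rightarrow> ennreal" where
  "target_time V E j = (\<Sum>i\<in>V. ennreal (stationary E i) * hitting_time E i j)"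

text \<open>
  The remaining facts confirm that \<open>srw\<close> is the law of the intended Markov chain and that the
  integral defining \<open>hitting_time\<close> is that of a measurable function.
\<close>

lemma sets_srw [measurable_cong]: "sets (srw E i) = sets (PiM UNIV (\<lambda>_. count_space UNIV))"
  unfolding srw_def by simp

lemma space_srw [simp]: "space (srw E i) = UNIV"
  using sets_eq_imp_space_eq[OF sets_srw] by (simp add: space_PiM)

lemma srw_cylinder_aux:
  "emeasure (SRW.C E i 0 (Suc n) (\<lambda>_. undefined)) {restrict x {0..<Suc n}} =
     ennreal (of_bool (x 0 = i) *
       (\<Prod>m<n. pmf (pmf_of_set (neighbours E (x m))) (x (Suc m))))"
proof -
  let ?u = "(\<lambda>_. undefined) :: nat \<Rightarrow> 'a"
  let ?M = "\<lambda>k. PiM {0..<k} (\<lambda>_. count_space (UNIV :: 'a set))"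
  let ?r = "\<lambda>k. restrict x {0..<k}"
  have sing: "{?r k} \<in> sets (?M k)" for k
  proof -
    have "{?r k} = PiE {0..<k} (\<lambda>m. {x m})"
      by (auto simp: PiE_iff extensional_def restrict_def fun_eq_iff)
    then show ?thesis
      by (simp add: sets_PiM_I_finite)
  qed
  have u: "?u \<in> space (?M 0)"
    by (simp add: space_PiM)
  have step: "emeasure (SRW.C E i 0 (Suc k) ?u) {?r (Suc k)} =
      emeasure (SRW.C E i 0 k ?u) {?r k} * emeasure (srw_kernel E i k (?r k)) {x k}" for k
  proof -
    have "SRW.eP E i k \<in> measurable (SRW.C E i 0 k ?u) (subprob_algebra (?M (Suc k)))"
      using SRW.measurable_eP[of E i k] SRW.sets_C[OF u, of E i k]
      by (subst measurable_cong_sets[OF _ refl, of _ "?M k"]) auto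
    then have "emeasure (SRW.C E i 0 (Suc k) ?u) {?r (Suc k)} =
        (\<integral>\<^sup>+\<omega>. emeasure (SRW.eP E i k \<omega>) {?r (Suc k)} \<partial>SRW.C E i 0 k ?u)"
      using SRW.space_C[OF u, of E i k] sing[of "Suc k"]
      by (simp, intro emeasure_bind[where N = "?M (Suc k)"])
        (simp_all add: space_PiM PiE_eq_empty_iff del: restrict_apply)
    also have "\<dots> = (\<integral>\<^sup>+\<omega>. emeasure (srw_kernel E i k (?r k)) {x k} * indicator {?r k} \<omega>
        \<partial>SRW.C E i 0 k ?u)"
    proof (intro nn_integral_cong)
      fix \<omega> assume "\<omega> \<in> space (SRW.C E i 0 k ?u)"
      then have \<omega>: "\<omega> \<in> space (?M k)"
        using SRW.space_C[OF u, of E i k] by simp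
      then have ext: "\<omega> \<in> extensional {0..<k}"
        by (simp add: space_PiM PiE_iff)
      have "(\<lambda>y. fun_upd \<omega> k y) -` {?r (Suc k)} = (if \<omega> = ?r k then {x k} else {})"
      proof -
        have "fun_upd \<omega> k y = ?r (Suc k) \<longleftrightarrow> \<omega> = ?r k \<and> y = x k" for y
        proof
          assume eq: "fun_upd \<omega> k y = ?r (Suc k)"
          have "\<omega> m = ?r k m" for m
            using fun_cong[OF eq, of m] ext by (cases "m = k") (auto simp: extensional_def restrict_def split: if_splits)
          then show "\<omega> = ?r k \<and> y = x k"
            using fun_cong[OF eq, of k] by auto
        next
          assume "\<omega> = ?r k \<and> y = x k"
          then show "fun_upd \<omega> k y = ?r (Suc k)"
            by (simp add: fun_eq_iff restrict_def)
        qed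
        moreover have "{y. P \<and> y = a} = (if P then {a} else {})" for P and a :: 'a
          by auto
        ultimately show ?thesis
          by (simp only: vimage_def singleton_iff)
      qed
      then show "emeasure (SRW.eP E i k \<omega>) {?r (Suc k)} =
          emeasure (srw_kernel E i k (?r k)) {x k} * indicator {?r k} \<omega>"
        using SRW.emeasure_eP[OF \<omega> sing[of "Suc k"], of E i] by (auto split: split_indicator)
    qed
    also have "\<dots> = emeasure (srw_kernel E i k (?r k)) {x k} * emeasure (SRW.C E i 0 k ?u) {?r k}"
      using sing[of k] SRW.sets_C[OF u, of E i k] by (intro nn_integral_cmult_indicator) simp
    finally show ?thesis
      by (simp add: mult.commute)
  qed
  show ?thesis
  proof (induction n)
    case 0
    have "{?r 0} = space (?M 0)"
      by (auto simp: space_PiM)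
    then have "emeasure (SRW.C E i 0 0 ?u) {?r 0} = 1"
      using sing[of 0] by (simp add: restrict_def)
    then show ?case
      unfolding step by (auto simp: srw_kernel_def split: split_indicator)
  next
    case (Suc n)
    have "emeasure (srw_kernel E i (Suc n) (?r (Suc n))) {x (Suc n)} =
        ennreal (pmf (pmf_of_set (neighbours E (x n))) (x (Suc n)))"
      by (simp add: srw_kernel_def emeasure_pmf_single)
    then have "emeasure (SRW.C E i 0 (Suc (Suc n)) ?u) {?r (Suc (Suc n))} =
        ennreal (of_bool (x 0 = i) *
          (\<Prod>m<n. pmf (pmf_of_set (neighbours E (x m))) (x (Suc m)))) *
        ennreal (pmf (pmf_of_set (neighbours E (x n))) (x (Suc n)))"
      by (simp only: step[of "Suc n"] Suc)
    then show ?case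
      by (simp only: ennreal_mult''[OF pmf_nonneg, symmetric] prod.lessThan_Suc mult.assoc)
  qed
qed

lemma emeasure_srw_cylinder:
  "emeasure (srw E i) {X. \<forall>m\<le>n. X m = x m} =
     ennreal (of_bool (x 0 = i) *
       (\<Prod>m<n. pmf (pmf_of_set (neighbours E (x m))) (x (Suc m))))"
proof -
  let ?J = "{0..<Suc n}"
  let ?A = "{restrict x ?J}"
  have A: "?A \<in> sets (PiM ?J (\<lambda>_. count_space UNIV))"
  proof -
    have "?A = PiE ?J (\<lambda>m. {x m})"
      by (auto simp: PiE_iff extensional_def restrict_def fun_eq_iff)
    then show ?thesis
      by (simp add: sets_PiM_I_finite)
  qed
  have "{X. \<forall>m\<le>n. X m = x m} = prod_emb UNIV (\<lambda>_. count_space UNIV) ?J ?A"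
  proof -
    have "(\<forall>m\<le>n. X m = x m) \<longleftrightarrow> restrict X ?J = restrict x ?J" for X
    proof
      assume eq: "restrict X ?J = restrict x ?J"
      show "\<forall>m\<le>n. X m = x m"
        using fun_cong[OF eq] by (metis atLeastLessThan_iff less_Suc_eq_le restrict_apply' zero_le)
    qed (auto simp: restrict_def fun_eq_iff)
    then show ?thesis
      by (auto simp: prod_emb_def)
  qed
  then have "emeasure (srw E i) {X. \<forall>m\<le>n. X m = x m} = emeasure (SRW.CI E i ?J) ?A"
    unfolding srw_def using SRW.lim[OF _ A] by simp
  also have "\<dots> = emeasure (SRW.C E i 0 (Suc n) (\<lambda>_. undefined)) ?A"
    using SRW.emeasure_CI[OF subset_refl A, of E i] A
    by (simp add: prod_emb_id sets.sets_into_space space_PiM del: SRW.C.simps)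
  finally show ?thesis
    using srw_cylinder_aux by metis
qed

lemma prob_space_srw: "prob_space (srw E i)"
proof
  have "prod_emb UNIV (\<lambda>_. count_space UNIV) {} {\<lambda>_. undefined} = (UNIV :: (nat \<Rightarrow> 'a) set)"
    by (auto simp: prod_emb_def)
  moreover have "emeasure (SRW.CI E i {}) {\<lambda>_. undefined} = 1"
    using prob_space.emeasure_space_1[OF SRW.PF.prob_space_P[of "{}" E i]]
    by (simp add: SRW.CI_def space_PiM)
  ultimately show "emeasure (srw E i) (space (srw E i)) = 1"
    using SRW.lim[of "{}" "{\<lambda>_. undefined}" E i] by (simp add: srw_def[symmetric] PiM_empty)
qed

lemma measurable_hit: "hit j \<in> borel_measurable (srw E i)"
proof -
  have "hit j X = (INF m. if 0 < m \<and> X m = j then of_nat m else \<top>)" (is "?l = (INF m. ?f m)") for X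
  proof (rule antisym)
    show "?l \<le> (INF m. ?f m)"
      unfolding hit_def by (intro INF_greatest) (auto intro: INF_lower)
    show "(INF m. ?f m) \<le> ?l"
      unfolding hit_def
    proof (rule INF_greatest)
      fix m assume "m \<in> {m. 0 < m \<and> X m = j}"
      then show "(INF m. ?f m) \<le> of_nat m"
        using INF_lower[of m UNIV ?f] by simp
    qed
  qed
  then have "hit j = (\<lambda>X. INF m. if 0 < m \<and> X m = j then of_nat m else \<top>)" ..
  also have "\<dots> \<in> borel_measurable (srw E i)"
    by measurable
  finally show ?thesis .
qed

end

theory Submission
  imports Defs "HOL-Real_Asymp.Real_Asymp"
begin

text \<open>
  Let \<open>f i\<close> be the hitting time of \<open>j\<close> from \<open>i \<noteq> j\<close>, and \<open>f j = 0\<close>. Off \<open>j\<close>, its Laplacian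
  \<open>\<Sum>v\<in>nb i. f i - f v\<close> equals the degree of \<open>i\<close>, so the Dirichlet energy of \<open>f\<close> is
  \<open>A = \<Sum>i. deg i * f i\<close>, and the target time is \<open>1 + A / vol\<close>. Keeping only the edges at \<open>j\<close>
  in the energy gives \<open>A \<ge> (vol - deg j)\<^sup>2 / deg j\<close>, with no information on the graph. Conversely,
  the mean \<open>A / vol\<close> of \<open>f\<close> is its mean over the neighbours of \<open>j\<close>, at most \<open>sqrt (A / deg j)\<close> by
  Cauchy-Schwarz, plus an error that a Poincare inequality controls. As the uniform distribution on
  the neighbours of \<open>j\<close> is already spread out, a spectral gap bounded below suffices to make
  this error negligible; it comes from Cheeger's inequality. Hence the target time is
  \<open>vol / deg j * (1 + o(1))\<close>.

  Chernoff bounds for the edge counts of all cuts, for the degrees and for the total number of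
  edges show that the graph is good enough as soon as \<open>N p\<close> is much larger than \<open>ln N\<close>. The
  hypothesis with \<open>C = 1\<close> gives \<open>N p \<ge> (ln N)\<^sup>2\<close>.
\<close>

section \<open>Energy and isoperimetry on a finite graph\<close>

lemma median_exists:
  fixes F :: "'a \<Rightarrow> real"
  assumes "finite V" "V \<noteq> {}"
  shows "\<exists>c. 2 * card {u \<in> V. c < F u} \<le> card V \<and> 2 * card {u \<in> V. F u < c} \<le> card V"
proof -
  define T where "T = {t \<in> F ` V. 2 * card {u \<in> V. F u < t} \<le> card V}"
  have fin: "finite T"
    using assms by (simp add: T_def)
  have "\<not> F u < Min (F ` V)" if "u \<in> V" for u
    using assms that by (metis Min_le finite_imageI image_eqI not_less)
  then have "{u \<in> V. F u < Min (F ` V)} = {}"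
    by blast
  then have "2 * card {u \<in> V. F u < Min (F ` V)} \<le> card V"
    by (metis card.empty mult_0_right zero_le)
  moreover have "Min (F ` V) \<in> F ` V"
    using assms by (intro Min_in) auto
  ultimately have "Min (F ` V) \<in> T"
    by (simp only: T_def mem_Collect_eq)
  then have ne: "T \<noteq> {}" by blast
  define c where "c = Max T"
  have cT: "c \<in> T"
    using fin ne by (simp add: c_def)
  have "2 * card {u \<in> V. c < F u} \<le> card V"
  proof (cases "{u \<in> V. c < F u} = {}")
    case False
    \<comment> \<open>\<open>t\<close> is the next value of \<open>F\<close> above \<open>c\<close>.
      Maximality of \<open>c\<close> keeps \<open>t\<close> out of \<open>T\<close>, so more than
      half of the vertices lie below \<open>t\<close>, and these are exactly the vertices not above
      \<open>c\<close>.\<close>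
    define t where "t = Min (F ` {u \<in> V. c < F u})"
    have t: "t \<in> F ` {u \<in> V. c < F u}"
      unfolding t_def using False assms by (intro Min_in) auto
    have t_le: "t \<le> F u" if "u \<in> V" "c < F u" for u
      unfolding t_def using that assms by (intro Min_le) auto
    have "t \<notin> T"
      using t Max_ge[OF fin, of t] by (auto simp: c_def)
    then have "card V < 2 * card {u \<in> V. F u < t}"
      using t by (auto simp: T_def)
    moreover have "{u \<in> V. F u < t} = V - {u \<in> V. c < F u}"
      using t t_le by force
    moreover have "card (V - {u \<in> V. c < F u}) = card V - card {u \<in> V. c < F u}"
      using assms by (intro card_Diff_subset) auto
    ultimately show ?thesis by simp
  next
    case True
    then show ?thesis by (metis card.empty mult_0_right zero_le)
  qed
  with cT show ?thesis
    by (auto simp: T_def)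
qed

section \<open>Finite simple graphs, sums over arcs and summation by parts\<close>

locale simple_graph =
  fixes V :: "'a set" and E :: "'a set set"
  assumes finite_V: "finite V" and edges: "E \<subseteq> {e. e \<subseteq> V \<and> card e = 2}"
begin

abbreviation nb :: "'a \<Rightarrow> 'a set" where
  "nb \<equiv> neighbours E"

abbreviation deg :: "'a \<Rightarrow> real" where
  "deg u \<equiv> real (degree E u)"

definition vol :: real where
  "vol = (\<Sum>u\<in>V. deg u)"

text \<open>Every edge is counted in both directions, so this is twice the usual Dirichlet energy.\<close>

definition energy :: "('a \<Rightarrow> real) \<Rightarrow> real" where
  "energy f = (\<Sum>u\<in>V. \<Sum>v\<in>nb u. (f u - f v)\<^sup>2)"

lemma nb_sym: "v \<in> nb u \<longleftrightarrow> u \<in> nb v"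
  by (simp add: neighbours_def insert_commute)

lemma nb_subset: "nb u \<subseteq> V"
  using edges by (auto simp: neighbours_def)

lemma nb_irrefl: "u \<notin> nb u"
  using edges by (auto simp: neighbours_def)

lemma finite_nb [simp]: "finite (nb u)"
  using nb_subset finite_V finite_subset by blast

text \<open>Reversal permutes the arcs because adjacency is symmetric. Every summation by parts
  below reduces to this.\<close>

lemma sum_arcs_swap: "(\<Sum>u\<in>V. \<Sum>v\<in>nb u. \<phi> u v) = (\<Sum>u\<in>V. \<Sum>v\<in>nb u. \<phi> v u)"
proof -
  have "(\<Sum>u\<in>V. \<Sum>v\<in>nb u. \<phi> u v) = (\<Sum>u\<in>V. \<Sum>v\<in>{v. v \<in> V \<and> v \<in> nb u}. \<phi> u v)"
    using nb_subset by (intro sum.cong refl) auto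
  also have "\<dots> = (\<Sum>v\<in>V. \<Sum>u\<in>{u. u \<in> V \<and> v \<in> nb u}. \<phi> u v)"
    by (rule sum.swap_restrict[OF finite_V finite_V])
  also have "\<dots> = (\<Sum>u\<in>V. \<Sum>v\<in>nb u. \<phi> v u)"
    using nb_subset nb_sym by (intro sum.cong refl) auto
  finally show ?thesis .
qed

lemma vol_eq: "vol = 2 * real (card E)"
proof -
  have finE: "finite E"
    using edges finite_V by (auto intro: finite_subset[of _ "Pow V"])
  have deg: "degree E u = card {e \<in> E. u \<in> e}" if "u \<in> V" for u
  proof -
    have "bij_betw (\<lambda>v. {u, v}) (nb u) {e \<in> E. u \<in> e}"
    proof (rule bij_betwI')
      fix e assume e: "e \<in> {e \<in> E. u \<in> e}"
      then have "card e = 2" using edges by auto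
      then obtain x y where "e = {x, y}" by (auto simp: card_2_iff)
      with e show "\<exists>v\<in>nb u. e = {u, v}"
        by (auto simp: neighbours_def insert_commute)
    qed (auto simp: neighbours_def doubleton_eq_iff)
    then show ?thesis
      by (simp add: degree_def bij_betw_same_card)
  qed
  have "(\<Sum>u\<in>V. degree E u) = (\<Sum>u\<in>V. \<Sum>e\<in>{e. e \<in> E \<and> u \<in> e}. 1)"
    using deg by simp
  also have "\<dots> = (\<Sum>e\<in>E. \<Sum>u\<in>{u. u \<in> V \<and> u \<in> e}. 1)"
    by (rule sum.swap_restrict[OF finite_V finE])
  also have "\<dots> = (\<Sum>e\<in>E. 2)"
  proof (intro sum.cong refl)
    fix e assume "e \<in> E"
    then have "{u. u \<in> V \<and> u \<in> e} = e" "card e = 2" using edges by auto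
    then show "(\<Sum>u\<in>{u. u \<in> V \<and> u \<in> e}. 1) = (2 :: nat)" by simp
  qed
  finally have "(\<Sum>u\<in>V. degree E u) = 2 * card E" by simp
  then show ?thesis
    unfolding vol_def by (metis of_nat_mult of_nat_numeral of_nat_sum)
qed

lemma energy_nonneg: "0 \<le> energy f"
  unfolding energy_def by (intro sum_nonneg) auto

lemma sum_deg_mult: "(\<Sum>u\<in>V. deg u * f u) = (\<Sum>u\<in>V. \<Sum>v\<in>nb u. f u)"
  by (simp add: degree_def)

text \<open>The square splits as \<open>f u * (f u - f v) + f v * (f v - f u)\<close>, and arc
  reversal gives both parts the same total.\<close>

lemma green: "energy f = 2 * (\<Sum>u\<in>V. f u * (\<Sum>v\<in>nb u. f u - f v))"
proof -
  have "(\<Sum>u\<in>V. f u * (\<Sum>v\<in>nb u. f u - f v)) = (\<Sum>u\<in>V. \<Sum>v\<in>nb u. f u * (f u - f v))"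
    by (simp add: sum_distrib_left)
  moreover have "\<dots> = (\<Sum>u\<in>V. \<Sum>v\<in>nb u. f v * (f v - f u))"
    by (rule sum_arcs_swap)
  moreover have "energy f = (\<Sum>u\<in>V. \<Sum>v\<in>nb u. f u * (f u - f v)) + (\<Sum>u\<in>V. \<Sum>v\<in>nb u. f v * (f v - f u))"
    unfolding energy_def sum.distrib[symmetric]
    by (intro sum.cong refl) (simp add: power2_eq_square algebra_simps)
  ultimately show ?thesis by simp
qed

lemma cauchy_schwarz_arcs:
  fixes a b :: "'a \<Rightarrow> 'a \<Rightarrow> real"
  shows "(\<Sum>u\<in>V. \<Sum>v\<in>nb u. a u v * b u v)\<^sup>2 \<le>
    (\<Sum>u\<in>V. \<Sum>v\<in>nb u. (a u v)\<^sup>2) * (\<Sum>u\<in>V. \<Sum>v\<in>nb u. (b u v)\<^sup>2)"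
  using Cauchy_Schwarz_ineq_sum[of "\<lambda>(u, v). a u v" "\<lambda>(u, v). b u v" "Sigma V nb"] finite_V
  by (simp add: sum.Sigma case_prod_unfold)

text \<open>Subtracting its least positive value from \<open>g\<close> on the support \<open>S\<close> lowers the left-hand side by
  \<open>2 \<alpha> m |S|\<close> and the right-hand side by \<open>2 m\<close> times the number of edges leaving \<open>S\<close>.\<close>

lemma coarea:
  assumes cut: "\<And>S. S \<subseteq> V \<Longrightarrow> 2 * card S \<le> card V \<Longrightarrow>
      \<alpha> * real (card S) \<le> (\<Sum>u\<in>S. real (card (nb u - S)))"
    and "\<And>u. u \<in> V \<Longrightarrow> 0 \<le> g u" "2 * card {u \<in> V. g u \<noteq> 0} \<le> card V"
  shows "2 * \<alpha> * (\<Sum>u\<in>V. g u) \<le> (\<Sum>u\<in>V. \<Sum>v\<in>nb u. \<bar>g u - g v\<bar>)"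
  using assms(2,3)
proof (induction "card {u \<in> V. g u \<noteq> 0}" arbitrary: g rule: less_induct)
  case less
  define S where "S = {u \<in> V. g u \<noteq> 0}"
  have S: "S \<subseteq> V" "finite S" using finite_V by (auto simp: S_def)
  show ?case
  proof (cases "S = {}")
    case True
    then have "g u = 0" if "u \<in> V" for u using that by (auto simp: S_def)
    then have "(\<Sum>u\<in>V. g u) = 0" by simp
    then show ?thesis by (simp add: sum_nonneg)
  next
    case False
    define m where "m = Min (g ` S)"
    have "m \<in> g ` S" unfolding m_def using S False by (intro Min_in) auto
    then obtain w where w: "w \<in> S" "g w = m" by auto
    have m_le: "m \<le> g u" if "u \<in> S" for u
      unfolding m_def using S that by (intro Min_le) auto
    have m0: "m \<noteq> 0" "m \<ge> 0" using w less.prems(1) by (auto simp: S_def)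
    define h where "h u = (if u \<in> S then g u - m else g u)" for u
    have h0: "0 \<le> h u" if "u \<in> V" for u
      using that m_le less.prems(1) by (simp add: h_def)
    have sub: "{u \<in> V. h u \<noteq> 0} \<subset> S"
      using w by (auto simp: h_def S_def)
    then have lt: "card {u \<in> V. h u \<noteq> 0} < card {u \<in> V. g u \<noteq> 0}"
      using S psubset_card_mono[of S] by (simp add: S_def)
    have IH: "2 * \<alpha> * (\<Sum>u\<in>V. h u) \<le> (\<Sum>u\<in>V. \<Sum>v\<in>nb u. \<bar>h u - h v\<bar>)"
      using less.hyps[OF lt h0] lt less.prems(2) by simp
    let ?c = "\<lambda>u v. of_bool (u \<in> S \<and> v \<notin> S) :: real"
    \<comment> \<open>Inside \<open>S\<close> the shift by \<open>m\<close> cancels, and outside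
      nothing changes. Across the boundary the outer value is 0 and the inner one stays nonnegative
      after the shift, so exactly \<open>m\<close> is lost.\<close>
    have abs: "\<bar>g u - g v\<bar> = \<bar>h u - h v\<bar> + m * (?c u v + ?c v u)" if "u \<in> V" "v \<in> V" for u v
    proof -
      have z: "g x = 0" if "x \<in> V" "x \<notin> S" for x using that by (auto simp: S_def)
      show ?thesis
        using m_le[of u] m_le[of v] z[of u] z[of v] that m0 by (auto simp: h_def)
    qed
    have c: "(\<Sum>u\<in>V. \<Sum>v\<in>nb u. ?c u v) = (\<Sum>u\<in>S. real (card (nb u - S)))"
    proof -
      have "(\<Sum>v\<in>nb u. ?c u v) = (if u \<in> S then real (card (nb u - S)) else 0)" for u
        by (simp add: of_bool_def sum.If_cases Diff_eq Collect_neg_eq)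
      then show ?thesis
        using S finite_V by (simp add: sum.If_cases Int_absorb1)
    qed
    have "(\<Sum>u\<in>V. \<Sum>v\<in>nb u. \<bar>g u - g v\<bar>) =
        (\<Sum>u\<in>V. \<Sum>v\<in>nb u. \<bar>h u - h v\<bar> + m * (?c u v + ?c v u))"
      using nb_subset abs by (intro sum.cong refl) blast
    also have "\<dots> = (\<Sum>u\<in>V. \<Sum>v\<in>nb u. \<bar>h u - h v\<bar>) +
        m * ((\<Sum>u\<in>V. \<Sum>v\<in>nb u. ?c u v) + (\<Sum>u\<in>V. \<Sum>v\<in>nb u. ?c v u))"
      by (simp only: sum.distrib sum_distrib_left distrib_left)
    also have "(\<Sum>u\<in>V. \<Sum>v\<in>nb u. ?c v u) = (\<Sum>u\<in>V. \<Sum>v\<in>nb u. ?c u v)"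
      by (rule sum_arcs_swap)
    finally have R: "(\<Sum>u\<in>V. \<Sum>v\<in>nb u. \<bar>g u - g v\<bar>) =
        (\<Sum>u\<in>V. \<Sum>v\<in>nb u. \<bar>h u - h v\<bar>) + 2 * m * (\<Sum>u\<in>S. real (card (nb u - S)))"
      unfolding c by (simp only: mult_2 distrib_left distrib_right add.assoc)
    have "(\<Sum>u\<in>V. g u) = (\<Sum>u\<in>V. h u + (if u \<in> S then m else 0))"
      by (intro sum.cong) (auto simp: h_def)
    also have "\<dots> = (\<Sum>u\<in>V. h u) + m * card S"
      using S finite_V by (simp add: sum.distrib sum.If_cases Int_absorb1)
    finally have L: "(\<Sum>u\<in>V. g u) = (\<Sum>u\<in>V. h u) + m * card S" .
    have "2 * m * (\<alpha> * card S) \<le> 2 * m * (\<Sum>u\<in>S. real (card (nb u - S)))"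
      using cut[OF S(1)] less.prems(2) m0 by (intro mult_left_mono) (auto simp: S_def)
    with IH show ?thesis unfolding L R by (simp add: algebra_simps)
  qed
qed

text \<open>Apply \<open>coarea\<close> to the square of \<open>g\<close>, factor the difference of
  squares, and separate the factors by Cauchy-Schwarz over arcs. The factor with sums is at most
  \<open>4 * \<Delta>\<close> times the sum of squares of \<open>g\<close>, one copy of which then
  cancels.\<close>

lemma cheeger:
  assumes cut: "\<And>S. S \<subseteq> V \<Longrightarrow> 2 * card S \<le> card V \<Longrightarrow>
      \<alpha> * real (card S) \<le> (\<Sum>u\<in>S. real (card (nb u - S)))"
    and \<alpha>: "0 < \<alpha>" and \<Delta>: "\<And>u. u \<in> V \<Longrightarrow> deg u \<le> \<Delta>"
    and g: "\<And>u. u \<in> V \<Longrightarrow> 0 \<le> g u" "2 * card {u \<in> V. g u \<noteq> 0} \<le> card V"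
  shows "\<alpha>\<^sup>2 * (\<Sum>u\<in>V. (g u)\<^sup>2) \<le> \<Delta> * energy g"
proof -
  let ?G = "\<Sum>u\<in>V. (g u)\<^sup>2"
  have G0: "0 \<le> ?G" by (intro sum_nonneg) auto
  have "2 * \<alpha> * ?G \<le> (\<Sum>u\<in>V. \<Sum>v\<in>nb u. \<bar>(g u)\<^sup>2 - (g v)\<^sup>2\<bar>)"
    using g(2) by (intro coarea[OF cut]) auto
  also have "\<dots> = (\<Sum>u\<in>V. \<Sum>v\<in>nb u. \<bar>g u - g v\<bar> * \<bar>g u + g v\<bar>)"
    by (simp add: abs_mult[symmetric] power2_eq_square algebra_simps)
  finally have "(2 * \<alpha> * ?G)\<^sup>2 \<le> (\<Sum>u\<in>V. \<Sum>v\<in>nb u. \<bar>g u - g v\<bar> * \<bar>g u + g v\<bar>)\<^sup>2"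
    using \<alpha> G0 by (intro power_mono) auto
  also have "\<dots> \<le> energy g * (\<Sum>u\<in>V. \<Sum>v\<in>nb u. (g u + g v)\<^sup>2)"
    using cauchy_schwarz_arcs[of "\<lambda>u v. \<bar>g u - g v\<bar>" "\<lambda>u v. \<bar>g u + g v\<bar>"] by (simp add: energy_def)
  also have "\<dots> \<le> energy g * (4 * \<Delta> * ?G)"
  proof (intro mult_left_mono energy_nonneg)
    have "(\<Sum>u\<in>V. \<Sum>v\<in>nb u. (g u + g v)\<^sup>2) \<le> (\<Sum>u\<in>V. \<Sum>v\<in>nb u. 2 * (g u)\<^sup>2 + 2 * (g v)\<^sup>2)"
    proof (intro sum_mono)
      fix u v show "(g u + g v)\<^sup>2 \<le> 2 * (g u)\<^sup>2 + 2 * (g v)\<^sup>2"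
        using zero_le_power2[of "g u - g v"] by (simp add: power2_eq_square algebra_simps)
    qed
    also have "\<dots> = 2 * (\<Sum>u\<in>V. \<Sum>v\<in>nb u. (g u)\<^sup>2) + 2 * (\<Sum>u\<in>V. \<Sum>v\<in>nb u. (g v)\<^sup>2)"
      by (simp only: sum.distrib sum_distrib_left)
    also have "\<dots> = 4 * (\<Sum>u\<in>V. deg u * (g u)\<^sup>2)"
      using sum_arcs_swap[of "\<lambda>u v. (g v)\<^sup>2"] by (simp add: sum_deg_mult)
    also have "\<dots> \<le> 4 * (\<Sum>u\<in>V. \<Delta> * (g u)\<^sup>2)"
      using \<Delta> by (intro mult_left_mono sum_mono mult_right_mono) auto
    finally show "(\<Sum>u\<in>V. \<Sum>v\<in>nb u. (g u + g v)\<^sup>2) \<le> 4 * \<Delta> * ?G"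
      by (simp add: sum_distrib_left mult.assoc)
  qed
  finally have "?G * (\<alpha>\<^sup>2 * ?G) \<le> ?G * (\<Delta> * energy g)"
    by (simp add: power2_eq_square algebra_simps)
  \<comment> \<open>This settles the case \<open>?G = 0\<close> of the cancellation. On an empty
    \<open>V\<close> nothing bounds \<open>\<Delta>\<close> from below, but there the energy
    vanishes.\<close>
  moreover have "0 \<le> \<Delta> * energy g"
  proof (cases "V = {}")
    case True
    have "energy g = 0" unfolding energy_def by (simp add: True)
    then show ?thesis by simp
  next
    case False
    then obtain u where "u \<in> V" by blast
    then have "0 \<le> \<Delta>" using \<Delta>[of u] of_nat_0_le_iff order_trans by blast
    then show ?thesis using energy_nonneg by simp
  qed
  ultimately show ?thesis
    using G0 by (cases "?G = 0") (auto simp: mult_le_cancel_left)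
qed

text \<open>Take for \<open>c\<close> a median of \<open>f\<close>. The positive and the negative
  part of \<open>f - c\<close> are then each supported on at most half of the vertices, so
  \<open>cheeger\<close> applies to both, and their energies add up to at most that of
  \<open>f\<close>.\<close>

lemma poincare:
  assumes cut: "\<And>S. S \<subseteq> V \<Longrightarrow> 2 * card S \<le> card V \<Longrightarrow>
      \<alpha> * real (card S) \<le> (\<Sum>u\<in>S. real (card (nb u - S)))"
    and \<alpha>: "0 < \<alpha>" and \<Delta>: "\<And>u. u \<in> V \<Longrightarrow> deg u \<le> \<Delta>" and "V \<noteq> {}"
  shows "\<exists>c. \<alpha>\<^sup>2 * (\<Sum>u\<in>V. (f u - c)\<^sup>2) \<le> \<Delta> * energy f"
proof -
  obtain c where c: "2 * card {u \<in> V. c < f u} \<le> card V" "2 * card {u \<in> V. f u < c} \<le> card V"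
    using median_exists[OF finite_V \<open>V \<noteq> {}\<close>] by blast
  define p where "p u = max (f u - c) 0" for u
  define n where "n u = max (c - f u) 0" for u
  have "{u \<in> V. p u \<noteq> 0} = {u \<in> V. c < f u}" "{u \<in> V. n u \<noteq> 0} = {u \<in> V. f u < c}"
    by (auto simp: p_def n_def max_def)
  then have "2 * card {u \<in> V. p u \<noteq> 0} \<le> card V" "2 * card {u \<in> V. n u \<noteq> 0} \<le> card V"
    using c by simp_all
  then have "\<alpha>\<^sup>2 * (\<Sum>u\<in>V. (p u)\<^sup>2) \<le> \<Delta> * energy p" "\<alpha>\<^sup>2 * (\<Sum>u\<in>V. (n u)\<^sup>2) \<le> \<Delta> * energy n"
    using cheeger[OF cut \<alpha> \<Delta>, of p] cheeger[OF cut \<alpha> \<Delta>, of n] by (simp_all add: p_def n_def)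
  then have "\<alpha>\<^sup>2 * ((\<Sum>u\<in>V. (p u)\<^sup>2) + (\<Sum>u\<in>V. (n u)\<^sup>2)) \<le> \<Delta> * (energy p + energy n)"
    by (simp add: algebra_simps)
  also have "(\<Sum>u\<in>V. (p u)\<^sup>2) + (\<Sum>u\<in>V. (n u)\<^sup>2) = (\<Sum>u\<in>V. (f u - c)\<^sup>2)"
    unfolding sum.distrib[symmetric]
    by (intro sum.cong refl) (auto simp: p_def n_def max_def power2_eq_square algebra_simps)
  also have "\<Delta> * (energy p + energy n) \<le> \<Delta> * energy f"
  proof (intro mult_left_mono)
    \<comment> \<open>Disjoint supports kill the products \<open>p u * n u\<close> and
      \<open>p v * n v\<close>. The surviving cross terms are nonnegative.\<close>
    have "(p u - p v)\<^sup>2 + (n u - n v)\<^sup>2 \<le> (f u - f v)\<^sup>2" for u v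
    proof -
      have "f u - f v = (p u - p v) - (n u - n v)" "p u * n u = 0" "p v * n v = 0"
        "0 \<le> p u * n v" "0 \<le> p v * n u"
        by (auto simp: p_def n_def max_def)
      note pn = this
      moreover have "((p u - p v) - (n u - n v))\<^sup>2 = (p u - p v)\<^sup>2 + (n u - n v)\<^sup>2
          - 2 * (p u * n u + p v * n v) + 2 * (p u * n v + p v * n u)"
        by (simp add: power2_eq_square algebra_simps)
      ultimately show ?thesis
        by (simp only: pn(1,2,3)) simp
    qed
    then show "energy p + energy n \<le> energy f"
      unfolding energy_def sum.distrib[symmetric] by (intro sum_mono)
    obtain u where "u \<in> V" using \<open>V \<noteq> {}\<close> by blast
    then show "0 \<le> \<Delta>" using \<Delta>[of u] of_nat_0_le_iff order_trans by blast
  qed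
  finally show ?thesis by blast
qed

section \<open>Energy at a vertex and the two bounds on a potential\<close>

lemma energy_ge_star:
  assumes "j \<in> V"
  shows "2 * (\<Sum>k\<in>nb j. (f j - f k)\<^sup>2) \<le> energy f"
proof -
  \<comment> \<open>The row \<open>u = j\<close> of the energy contains this sum once. It is found a
    second time among the rows of the neighbours, since each edge at \<open>j\<close> is also an arc
    into \<open>j\<close>.\<close>
  have "(\<Sum>k\<in>nb j. (f j - f k)\<^sup>2) = (\<Sum>u\<in>nb j. \<Sum>v\<in>{j}. (f u - f v)\<^sup>2)"
    by (simp add: power2_commute)
  also have "\<dots> \<le> (\<Sum>u\<in>nb j. \<Sum>v\<in>nb u. (f u - f v)\<^sup>2)"
    using nb_sym by (intro sum_mono sum_mono2) auto
  also have "\<dots> \<le> (\<Sum>u\<in>V - {j}. \<Sum>v\<in>nb u. (f u - f v)\<^sup>2)"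
    using nb_irrefl nb_subset finite_V by (intro sum_mono2 sum_nonneg) auto
  also have "\<dots> = energy f - (\<Sum>k\<in>nb j. (f j - f k)\<^sup>2)"
    using assms finite_V by (simp add: energy_def sum_diff1)
  finally show ?thesis by simp
qed

lemma sum_nb_le_energy:
  assumes "j \<in> V" "f j = 0"
  shows "2 * (\<Sum>k\<in>nb j. f k)\<^sup>2 \<le> deg j * energy f"
proof -
  have "(\<Sum>k\<in>nb j. f k)\<^sup>2 \<le> deg j * (\<Sum>k\<in>nb j. (f k)\<^sup>2)"
    using Cauchy_Schwarz_ineq_sum[of "\<lambda>_. 1" f "nb j"] by (simp add: degree_def)
  also have "2 * \<dots> \<le> deg j * energy f"
    using mult_left_mono[OF energy_ge_star[OF assms(1), of f], of "deg j"] assms(2)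
    by (simp add: mult.left_commute)
  finally show ?thesis by simp
qed

text \<open>The Laplacian sums to zero over \<open>V\<close>, so its value at \<open>j\<close>
  balances the degrees of all other vertices. \<open>green\<close> then identifies the energy, and
  Cauchy-Schwarz on the star at \<open>j\<close> bounds it from below.\<close>

lemma potential_lower:
  assumes j: "j \<in> V" "0 < deg j" "f j = 0"
    and harm: "\<And>i. i \<in> V \<Longrightarrow> i \<noteq> j \<Longrightarrow> (\<Sum>v\<in>nb i. f i - f v) = deg i"
  shows "(\<Sum>k\<in>nb j. f k) = vol - deg j"
    and "(vol - deg j)\<^sup>2 / deg j \<le> (\<Sum>u\<in>V. deg u * f u)"
proof -
  have "(\<Sum>u\<in>V. \<Sum>v\<in>nb u. f u - f v) = 0"
    using sum_arcs_swap[of "\<lambda>u v. f v"] by (simp add: sum_subtractf)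
  moreover have "(\<Sum>u\<in>V. \<Sum>v\<in>nb u. f u - f v) = (\<Sum>v\<in>nb j. f j - f v) + (\<Sum>u\<in>V-{j}. deg u)"
    using finite_V j harm by (simp add: sum.remove)
  moreover have "vol = deg j + (\<Sum>u\<in>V-{j}. deg u)"
    using finite_V j by (simp add: vol_def sum.remove)
  ultimately show M: "(\<Sum>k\<in>nb j. f k) = vol - deg j"
    using j by (simp add: sum_subtractf sum_negf)
  have "(\<Sum>u\<in>V. f u * (\<Sum>v\<in>nb u. f u - f v)) = (\<Sum>u\<in>V. deg u * f u)"
    using harm j by (intro sum.cong) (auto simp: mult.commute)
  then have "energy f = 2 * (\<Sum>u\<in>V. deg u * f u)"
    using green[of f] by simp
  then show "(vol - deg j)\<^sup>2 / deg j \<le> (\<Sum>u\<in>V. deg u * f u)"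
    using sum_nb_le_energy[of j f] j by (simp add: M divide_simps mult.commute)
qed

text \<open>Off \<open>j\<close> the Laplacian is bounded above rather than prescribed, because the
  estimate is first applied to truncated hitting times, where it yields their convergence.\<close>

lemma potential_upper:
  assumes cut: "\<And>S. S \<subseteq> V \<Longrightarrow> 2 * card S \<le> card V \<Longrightarrow>
      \<alpha> * real (card S) \<le> (\<Sum>u\<in>S. real (card (nb u - S)))"
    and \<alpha>: "0 < \<alpha>" and \<Delta>: "\<And>u. u \<in> V \<Longrightarrow> deg u \<le> \<Delta>"
    and j: "j \<in> V" "0 < deg j" "f j = 0" and f0: "\<And>u. u \<in> V \<Longrightarrow> 0 \<le> f u"
    and sub: "\<And>i. i \<in> V \<Longrightarrow> i \<noteq> j \<Longrightarrow> (\<Sum>v\<in>nb i. f i - f v) \<le> deg i"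
  shows "(\<Sum>u\<in>V. deg u * f u) \<le>
    vol\<^sup>2 / deg j * (1 + sqrt ((\<Delta> * deg j / vol + 1) * (2 * \<Delta> / \<alpha>\<^sup>2)))\<^sup>2"
proof -
  define A where "A = (\<Sum>u\<in>V. deg u * f u)"
  define s where "s = sqrt ((\<Delta> * deg j / vol + 1) * (2 * \<Delta> / \<alpha>\<^sup>2))"
  define M where "M = (\<Sum>k\<in>nb j. f k)"
  have A0: "0 \<le> A" unfolding A_def using f0 by (intro sum_nonneg) auto
  have vol: "deg j \<le> vol"
    unfolding vol_def using finite_V j by (intro member_le_sum) auto
  have vol0: "0 < vol" using vol j(2) by linarith
  have \<Delta>0: "0 \<le> \<Delta>" using \<Delta>[OF j(1)] j(2) by linarith
  have s0: "0 \<le> s" unfolding s_def using \<Delta>0 vol0 by simp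
  have eA: "energy f \<le> 2 * A"
  proof -
    have "(\<Sum>u\<in>V. f u * (\<Sum>v\<in>nb u. f u - f v)) \<le> A"
      unfolding A_def
    proof (rule sum_mono)
      fix u assume "u \<in> V"
      then show "f u * (\<Sum>v\<in>nb u. f u - f v) \<le> deg u * f u"
        using j f0[of u] sub[of u] by (cases "u = j") (auto simp: mult.commute[of "f u"] intro: mult_right_mono)
    qed
    then show ?thesis using green[of f] by simp
  qed
  have Mb: "M / deg j \<le> sqrt (A / deg j)"
  proof (rule real_le_rsqrt)
    have "M\<^sup>2 \<le> deg j * A"
      using sum_nb_le_energy[of j f] mult_left_mono[OF eA, of "deg j"] j
      unfolding M_def by linarith
    then show "(M / deg j)\<^sup>2 \<le> A / deg j"
      using j(2) by (simp add: power_divide divide_simps power2_eq_square mult.commute)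
  qed
  \<comment> \<open>\<open>w\<close> is the stationary distribution minus the uniform distribution
    on the neighbours of \<open>j\<close>. Its total mass is zero, so the constant \<open>c\<close>
    may be subtracted from \<open>f\<close>.\<close>
  define w where "w k = deg k / vol - of_bool (k \<in> nb j) / deg j" for k
  have nbsum: "(\<Sum>k\<in>V. of_bool (k \<in> nb j) * x k) = (\<Sum>k\<in>nb j. x k)" for x :: "'a \<Rightarrow> real"
    using finite_V nb_subset[of j] by (simp add: of_bool_def if_distrib[of "\<lambda>y. y * _"] sum.If_cases Int_absorb1 cong: if_cong)
  obtain c where c: "\<alpha>\<^sup>2 * (\<Sum>u\<in>V. (f u - c)\<^sup>2) \<le> \<Delta> * energy f"
    using poincare[OF cut \<alpha> \<Delta>, of f] j(1) by blast
  have wsum: "(\<Sum>k\<in>V. w k) = 0"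
    using nbsum[of "\<lambda>_. 1"] vol0 j(2)
    by (simp add: w_def sum_subtractf vol_def[symmetric] flip: sum_divide_distrib) (simp add: degree_def)
  have "A / vol - M / deg j = (\<Sum>k\<in>V. w k * f k)"
    using nbsum[of f]
    by (simp add: w_def left_diff_distrib sum_subtractf A_def M_def flip: sum_divide_distrib)
  also have "\<dots> = (\<Sum>k\<in>V. w k * (f k - c))"
    using wsum by (simp add: right_diff_distrib sum_subtractf flip: sum_distrib_right)
  finally have "(A / vol - M / deg j)\<^sup>2 \<le> (\<Sum>k\<in>V. (w k)\<^sup>2) * (\<Sum>k\<in>V. (f k - c)\<^sup>2)"
    using Cauchy_Schwarz_ineq_sum[of w "\<lambda>k. f k - c" V] by simp
  also have "\<dots> \<le> (\<Delta> / vol + 1 / deg j) * (2 * \<Delta> / \<alpha>\<^sup>2 * A)"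
  proof (intro mult_mono)
    have "(\<Sum>k\<in>V. (w k)\<^sup>2) \<le> (\<Sum>k\<in>V. \<Delta> * deg k / vol\<^sup>2 + of_bool (k \<in> nb j) / (deg j)\<^sup>2)"
    proof (rule sum_mono)
      fix k assume k: "k \<in> V"
      \<comment> \<open>The mixed term of the square is nonpositive and is dropped.\<close>
      have "(w k)\<^sup>2 \<le> (deg k / vol)\<^sup>2 + (of_bool (k \<in> nb j) / deg j)\<^sup>2"
        using vol0 j(2) by (simp add: w_def power2_diff)
      also have "(deg k / vol)\<^sup>2 \<le> \<Delta> * deg k / vol\<^sup>2"
        using \<Delta>[OF k] by (simp add: power_divide power2_eq_square divide_right_mono mult_right_mono)
      finally show "(w k)\<^sup>2 \<le> \<Delta> * deg k / vol\<^sup>2 + of_bool (k \<in> nb j) / (deg j)\<^sup>2"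
        by (auto simp: power_divide)
    qed
    also have "\<dots> = \<Delta> * vol / vol\<^sup>2 + deg j / (deg j)\<^sup>2"
      using nbsum[of "\<lambda>_. 1"]
      by (simp add: sum.distrib vol_def flip: sum_divide_distrib sum_distrib_left) (simp add: degree_def)
    also have "\<dots> = \<Delta> / vol + 1 / deg j"
      using vol0 j(2) by (simp add: power2_eq_square)
    finally show "(\<Sum>k\<in>V. (w k)\<^sup>2) \<le> \<Delta> / vol + 1 / deg j" .
    have "\<alpha>\<^sup>2 * (\<Sum>u\<in>V. (f u - c)\<^sup>2) \<le> \<Delta> * (2 * A)"
      using c mult_left_mono[OF eA \<Delta>0] by linarith
    then show "(\<Sum>k\<in>V. (f k - c)\<^sup>2) \<le> 2 * \<Delta> / \<alpha>\<^sup>2 * A"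
      using \<alpha> by (simp add: field_simps)
  qed (use \<Delta>0 vol0 in \<open>auto intro!: sum_nonneg\<close>)
  also have "\<dots> = s\<^sup>2 * (A / deg j)"
    using \<Delta>0 vol0 j(2) by (simp add: s_def field_simps)
  finally have "A / vol - M / deg j \<le> sqrt (s\<^sup>2 * (A / deg j))"
    by (rule real_le_rsqrt)
  also have "\<dots> = s * sqrt (A / deg j)"
    using s0 by (subst real_sqrt_mult) simp
  \<comment> \<open>\<open>A\<close> is now bounded by a multiple of its own square root. Dividing
    by \<open>sqrt A\<close>, when it is nonzero, and squaring gives the claim.\<close>
  finally have "A / vol \<le> (1 + s) * sqrt (A / deg j)"
    using Mb by (simp add: algebra_simps)
  then have "A \<le> vol * (1 + s) / sqrt (deg j) * sqrt A"
    using vol0 by (simp add: real_sqrt_divide field_simps)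
  then have "sqrt A * sqrt A \<le> vol * (1 + s) / sqrt (deg j) * sqrt A"
    using A0 by simp
  moreover have "0 \<le> vol * (1 + s) / sqrt (deg j)"
    using vol0 s0 by simp
  ultimately have "sqrt A \<le> vol * (1 + s) / sqrt (deg j)"
    using A0 by (cases "A = 0") (simp_all only: mult_le_cancel_right real_sqrt_eq_zero_cancel_iff real_sqrt_zero, auto)
  then have "(sqrt A)\<^sup>2 \<le> (vol * (1 + s) / sqrt (deg j))\<^sup>2"
    using A0 by (intro power_mono) auto
  then show ?thesis
    using A0 unfolding A_def[symmetric] s_def[symmetric]
    by (simp add: power_divide power_mult_distrib)
qed

text \<open>A nonempty set that no edge leaves contains more than half of the vertices. A connected
  component and its complement cannot both do so.\<close>

lemma connected_if_cut:
  assumes cut: "\<And>S. S \<subseteq> V \<Longrightarrow> 2 * card S \<le> card V \<Longrightarrow>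
      \<alpha> * real (card S) \<le> (\<Sum>u\<in>S. real (card (nb u - S)))"
    and \<alpha>: "0 < \<alpha>"
  shows "graph_connected V E"
proof -
  let ?R = "{(x, y). {x, y} \<in> E}\<^sup>*"
  have no_cut: "S = {} \<or> card V < 2 * card S" if "S \<subseteq> V" "\<And>u. u \<in> S \<Longrightarrow> nb u \<subseteq> S" for S
  proof (rule ccontr)
    assume neg: "\<not> (S = {} \<or> card V < 2 * card S)"
    then have "\<alpha> * real (card S) \<le> (\<Sum>u\<in>S. real (card (nb u - S)))"
      using cut[OF that(1)] by simp
    also have "\<dots> = (\<Sum>u\<in>S. 0)"
      using that(2) by (intro sum.cong refl) (simp add: Diff_eq_empty_iff[THEN iffD2])
    finally have "card S = 0" using \<alpha> by (simp add: mult_le_0_iff)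
    moreover have "finite S" using that(1) finite_V finite_subset by blast
    ultimately show False using neg by simp
  qed
  show ?thesis unfolding graph_connected_def
  proof (intro ballI)
    fix u v assume uv: "u \<in> V" "v \<in> V"
    define S where "S = {x \<in> V. (u, x) \<in> ?R}"
    have S: "nb x \<subseteq> S" if "x \<in> S" for x
      using that nb_subset[of x] by (auto simp: S_def neighbours_def intro: rtrancl_into_rtrancl)
    have "nb x \<subseteq> V - S" if "x \<in> V - S" for x
      using that nb_subset[of x] S nb_sym by blast
    then have "V - S = {} \<or> card V < 2 * card (V - S)"
      by (intro no_cut) auto
    moreover have "S = {} \<or> card V < 2 * card S"
      using S by (intro no_cut) (auto simp: S_def)
    moreover have "u \<in> S" using uv by (simp add: S_def)
    moreover have "card (V - S) = card V - card S"
      using finite_V by (intro card_Diff_subset) (auto simp: S_def)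
    ultimately have "V - S = {}" by auto
    then show "(u, v) \<in> ?R" using uv by (auto simp: S_def)
  qed
qed

end

section \<open>Hitting times as sums of survival probabilities\<close>

text \<open>This is the probability that the walk from \<open>i\<close> moves along
  \<open>xs\<close>. Lists turn first-step decomposition into structural recursion.\<close>

fun path_weight :: "'a set set \<Rightarrow> 'a \<Rightarrow> 'a list \<Rightarrow> real" where
  "path_weight E i [] = 1"
| "path_weight E i (x # xs) = pmf (pmf_of_set (neighbours E i)) x * path_weight E x xs"

lemma path_weight_nonneg: "0 \<le> path_weight E i xs"
  by (induction xs arbitrary: i) auto

lemma path_weight_eq_prod:
  "(\<Prod>m<length xs. pmf (pmf_of_set (neighbours E ((i # xs) ! m))) ((i # xs) ! Suc m)) = path_weight E i xs"
  by (induction xs arbitrary: i) (simp_all add: prod.lessThan_Suc_shift del: prod.lessThan_Suc)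

lemma emeasure_srw_path:
  "emeasure (srw E i) {X. \<forall>m\<le>length xs. X m = (i # xs) ! m} = ennreal (path_weight E i xs)"
  unfolding emeasure_srw_cylinder using path_weight_eq_prod[of E i xs] by simp

text \<open>For finite \<open>B\<close> this is the probability that the walk from \<open>i\<close>
  is in \<open>B\<close> at times 1 to \<open>n\<close>; its position at time 0 is not
  restricted.\<close>

definition stay :: "'a set set \<Rightarrow> 'a set \<Rightarrow> nat \<Rightarrow> 'a \<Rightarrow> real" where
  "stay E B n i = (\<Sum>xs | set xs \<subseteq> B \<and> length xs = n. path_weight E i xs)"

lemma stay_0: "stay E B 0 i = 1"
proof -
  have "{xs. set xs \<subseteq> B \<and> length xs = 0} = {[]}" by auto
  then show ?thesis by (simp add: stay_def del: length_0_conv)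
qed

text \<open>The Markov property at time 1, obtained by splitting off the head of each path.\<close>

lemma stay_Suc: "stay E B (Suc n) i = (\<Sum>x\<in>B. pmf (pmf_of_set (neighbours E i)) x * stay E B n x)"
proof -
  let ?L = "{xs. set xs \<subseteq> B \<and> length xs = n}"
  have "{xs. set xs \<subseteq> B \<and> length xs = Suc n} = (\<lambda>(x, xs). x # xs) ` (B \<times> ?L)"
    by (auto simp: length_Suc_conv image_iff)
  then have "stay E B (Suc n) i = (\<Sum>(x, xs)\<in>B \<times> ?L. path_weight E i (x # xs))"
    unfolding stay_def by (simp add: sum.reindex inj_on_def case_prod_unfold)
  then show ?thesis
    by (simp add: stay_def sum_distrib_left sum.cartesian_product)
qed

text \<open>The event is a finite disjoint union of cylinders, one for each list of \<open>n\<close>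
  elements of \<open>B\<close>. Cylinders fix time 0, hence the clause
  \<open>X 0 = i\<close>.\<close>

lemma emeasure_srw_stay:
  assumes "finite B"
  shows "emeasure (srw E i) {X. X 0 = i \<and> (\<forall>m\<in>{1..n}. X m \<in> B)} = ennreal (stay E B n i)"
proof -
  let ?L = "{xs. set xs \<subseteq> B \<and> length xs = n}"
  let ?C = "\<lambda>xs. {X. \<forall>m\<le>length xs. X m = (i # xs) ! m}"
  have C: "?C xs \<in> sets (srw E i)" for xs
  proof -
    have "{X \<in> space (srw E i). \<forall>m\<le>length xs. X m = (i # xs) ! m} \<in> sets (srw E i)"
      by measurable
    then show ?thesis by simp
  qed
  have fin: "finite ?L"
    using assms by (rule finite_lists_length_eq)
  have set_eq: "{X. X 0 = i \<and> (\<forall>m\<in>{1..n}. X m \<in> B)} = (\<Union>xs\<in>?L. ?C xs)"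
  proof (intro equalityI subsetI)
    fix X assume X: "X \<in> {X. X 0 = i \<and> (\<forall>m\<in>{1..n}. X m \<in> B)}"
    have "X m = (i # map (\<lambda>k. X (Suc k)) [0..<n]) ! m" if "m \<le> n" for m
      using X that by (cases m) auto
    then have "X \<in> ?C (map (\<lambda>k. X (Suc k)) [0..<n])" by simp
    moreover have "map (\<lambda>k. X (Suc k)) [0..<n] \<in> ?L"
      using X by auto
    ultimately show "X \<in> (\<Union>xs\<in>?L. ?C xs)" by blast
  next
    fix X assume "X \<in> (\<Union>xs\<in>?L. ?C xs)"
    then obtain xs where xs: "set xs \<subseteq> B" "length xs = n" "\<forall>m\<le>n. X m = (i # xs) ! m" by auto
    then have "X m \<in> B" if "m \<in> {1..n}" for m
      using that by (cases m) (auto simp: subset_eq)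
    then show "X \<in> {X. X 0 = i \<and> (\<forall>m\<in>{1..n}. X m \<in> B)}"
      using xs by auto
  qed
  have disj: "disjoint_family_on ?C ?L"
  proof -
    have "xs = ys" if "length xs = n" "length ys = n" "X \<in> ?C xs" "X \<in> ?C ys" for xs ys X
    proof (rule nth_equalityI)
      fix k assume "k < length xs"
      then have k: "Suc k \<le> length xs" "Suc k \<le> length ys" using that(1,2) by auto
      from that(3) k(1) have "X (Suc k) = xs ! k" by auto
      moreover from that(4) k(2) have "X (Suc k) = ys ! k" by auto
      ultimately show "xs ! k = ys ! k" by simp
    qed (use that in simp)
    note eq = this
    show ?thesis
      unfolding disjoint_family_on_def
    proof (intro ballI impI)
      fix xs ys assume "xs \<in> ?L" "ys \<in> ?L" "xs \<noteq> ys"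
      then show "?C xs \<inter> ?C ys = {}"
        using eq[of xs ys] by blast
    qed
  qed
  have "emeasure (srw E i) (\<Union>xs\<in>?L. ?C xs) = (\<Sum>xs\<in>?L. emeasure (srw E i) (?C xs))"
    using C fin disj by (intro sum_emeasure[symmetric]) auto
  also have "\<dots> = (\<Sum>xs\<in>?L. ennreal (path_weight E i xs))"
    by (intro sum.cong refl emeasure_srw_path)
  also have "\<dots> = ennreal (stay E B n i)"
    by (simp add: stay_def sum_ennreal path_weight_nonneg)
  finally show ?thesis by (simp only: set_eq)
qed

text \<open>The tail-sum formula, trajectory by trajectory: summand \<open>n\<close> indicates that
  the hitting time exceeds \<open>n\<close>. A trajectory that never hits gives
  \<open>\<top>\<close> on both sides.\<close>

lemma hit_eq_suminf:
  "hit j X = (\<Sum>n. indicator {X. \<forall>m. 0 < m \<and> m \<le> n \<longrightarrow> X m \<noteq> j} X)"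
proof (cases "\<exists>m>0. X m = j")
  case False
  then have "{m. 0 < m \<and> X m = j} = {}" by auto
  then have "hit j X = \<top>" by (simp only: hit_def) simp
  moreover have "X \<in> {X. \<forall>m. 0 < m \<and> m \<le> n \<longrightarrow> X m \<noteq> j}" for n using False by blast
  then have "indicator {X. \<forall>m. 0 < m \<and> m \<le> n \<longrightarrow> X m \<noteq> j} X = (1 :: ennreal)" for n
    by (simp only: indicator_simps)
  moreover have "(\<Sum>n. 1 :: ennreal) = \<top>"
    by (simp add: suminf_eq_SUP ennreal_SUP_of_nat_eq_top)
  ultimately show ?thesis by simp
next
  case True
  define t where "t = (LEAST m. 0 < m \<and> X m = j)"
  have t: "0 < t" "X t = j"
    using LeastI_ex[OF True[unfolded Bex_def]] by (auto simp: t_def)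
  have le: "t \<le> m" if "0 < m" "X m = j" for m
    unfolding t_def using that by (intro Least_le) auto
  have "hit j X = of_nat t"
    unfolding hit_def
  proof (rule antisym)
    show "(INF m\<in>{m. 0 < m \<and> X m = j}. of_nat m) \<le> (of_nat t :: ennreal)"
      using t by (intro INF_lower) auto
    show "(of_nat t :: ennreal) \<le> (INF m\<in>{m. 0 < m \<and> X m = j}. of_nat m)"
      using le by (intro INF_greatest) auto
  qed
  moreover have "indicator {X. \<forall>m. 0 < m \<and> m \<le> n \<longrightarrow> X m \<noteq> j} X = (of_bool (n < t) :: ennreal)" for n
  proof -
    have "(\<forall>m. 0 < m \<and> m \<le> n \<longrightarrow> X m \<noteq> j) \<longleftrightarrow> n < t"
    proof
      assume "\<forall>m. 0 < m \<and> m \<le> n \<longrightarrow> X m \<noteq> j"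
      with t show "n < t" using not_le_imp_less by blast
    next
      assume "n < t"
      show "\<forall>m. 0 < m \<and> m \<le> n \<longrightarrow> X m \<noteq> j"
      proof (intro allI impI)
        fix m assume "0 < m \<and> m \<le> n"
        with le[of m] \<open>n < t\<close> show "X m \<noteq> j" by linarith
      qed
    qed
    then show ?thesis by (simp only: indicator_def mem_Collect_eq)
  qed
  moreover have "(\<Sum>n. of_bool (n < t) :: ennreal) = (\<Sum>n<t. of_bool (n < t))"
    by (rule suminf_finite) auto
  ultimately show ?thesis by simp
qed

section \<open>Survival probabilities and bounds on the target time\<close>

context simple_graph
begin

text \<open>In a graph without isolated vertices this is the probability that the walk from
  \<open>i\<close> avoids \<open>j\<close> at times 1 to \<open>n\<close>. Time 0 is free, so
  \<open>i = j\<close> gives the tail of the return time.\<close>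

primrec surv :: "'a \<Rightarrow> nat \<Rightarrow> 'a \<Rightarrow> real" where
  "surv j 0 i = 1"
| "surv j (Suc n) i = (\<Sum>k\<in>nb i - {j}. surv j n k) / deg i"

lemma surv_nonneg: "0 \<le> surv j n i"
  by (induction n arbitrary: i) (auto intro!: divide_nonneg_nonneg sum_nonneg)

lemma sum_pmf_nb:
  assumes "nb i \<noteq> {}" "B \<subseteq> V"
  shows "(\<Sum>x\<in>B. pmf (pmf_of_set (nb i)) x * g x) = (\<Sum>x\<in>nb i \<inter> B. g x) / deg i"
proof -
  have "(\<Sum>x\<in>B. pmf (pmf_of_set (nb i)) x * g x) = (\<Sum>x\<in>B. if x \<in> nb i then g x / deg i else 0)"
    using assms(1) by (intro sum.cong) (auto simp: degree_def)
  also have "\<dots> = (\<Sum>x\<in>nb i \<inter> B. g x / deg i)"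
    using finite_subset[OF assms(2) finite_V] by (simp add: sum.If_cases Int_commute)
  finally show ?thesis by (simp add: sum_divide_distrib)
qed

text \<open>Avoiding \<open>j\<close> admits every other element of the type, while
  \<open>emeasure_srw_stay\<close> needs a finite set. The walk almost surely starts at
  \<open>i\<close> and stays in \<open>V\<close>, so \<open>V - {j}\<close> serves instead.\<close>

lemma emeasure_surv:
  assumes ne: "\<And>u. u \<in> V \<Longrightarrow> nb u \<noteq> {}" and i: "i \<in> V"
  shows "emeasure (srw E i) {X. \<forall>m. 0 < m \<and> m \<le> n \<longrightarrow> X m \<noteq> j} = ennreal (surv j n i)"
proof -
  let ?A = "{X. \<forall>m. 0 < m \<and> m \<le> n \<longrightarrow> X m \<noteq> j}"
  let ?B = "\<lambda>B. {X. X 0 = i \<and> (\<forall>m\<in>{1..n}. X m \<in> B)}"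
  interpret prob_space "srw E i" by (rule prob_space_srw)
  have "nb u \<inter> V = nb u" "nb u \<inter> (V - {j}) = nb u - {j}" for u
    using nb_subset by auto
  note Int = this
  have deg0: "deg u \<noteq> 0" if "u \<in> V" for u
    using ne[OF that] by (simp add: degree_def)
  have "stay E V n u = 1" if "u \<in> V" for u
    using that
  proof (induction n arbitrary: u)
    case (Suc n)
    have "(\<Sum>x\<in>nb u. stay E V n x) = (\<Sum>x\<in>nb u. 1)"
      using Suc.IH nb_subset by (intro sum.cong) auto
    then show ?case
      using deg0[OF Suc.prems] unfolding stay_Suc sum_pmf_nb[OF ne[OF Suc.prems] subset_refl] Int
      by (simp add: degree_def)
  qed (simp add: stay_0)
  then have full: "emeasure (srw E i) (?B V) = 1"
    using emeasure_srw_stay[OF finite_V, of E i n] i by simp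
  have stay: "stay E (V - {j}) n u = surv j n u" if "u \<in> V" for u
    using that
  proof (induction n arbitrary: u)
    case (Suc n)
    have "(\<Sum>x\<in>nb u - {j}. stay E (V - {j}) n x) = (\<Sum>x\<in>nb u - {j}. surv j n x)"
      using Suc.IH nb_subset by (intro sum.cong) auto
    then show ?case
      unfolding stay_Suc sum_pmf_nb[OF ne[OF Suc.prems] Diff_subset] Int by simp
  qed (simp add: stay_0)
  have meas [measurable]: "Measurable.pred (srw E i) (\<lambda>X. X m \<in> B)" for m B
  proof -
    have "(\<lambda>X. X m) \<in> measurable (srw E i) (count_space UNIV)" by measurable
    from measurable_compose[OF this, of "\<lambda>x. x \<in> B" "count_space UNIV"] show ?thesis
      by simp
  qed
  have BV: "?B V \<in> sets (srw E i)" "?B (V - {j}) \<in> sets (srw E i)"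
  proof -
    have "{X \<in> space (srw E i). X 0 = i \<and> (\<forall>m\<in>{1..n}. X m \<in> B)} \<in> sets (srw E i)" for B
      by measurable
    from this[of V] this[of "V - {j}"]
    show "?B V \<in> sets (srw E i)" "?B (V - {j}) \<in> sets (srw E i)"
      by (simp_all only: space_srw UNIV_I simp_thms)
  qed
  have A: "?A \<in> sets (srw E i)"
  proof -
    have "{X \<in> space (srw E i). \<forall>m. 0 < m \<and> m \<le> n \<longrightarrow> X m \<noteq> j} \<in> sets (srw E i)"
      by measurable
    then show ?thesis by simp
  qed
  have "AE X in srw E i. X \<in> ?B V"
    using full BV by (intro AE_prob_1) (simp add: measure_def)
  then have "AE X in srw E i. X \<in> ?A \<longleftrightarrow> X \<in> ?B (V - {j})"
    by eventually_elim (auto simp: Suc_le_eq)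
  then have "emeasure (srw E i) ?A = emeasure (srw E i) (?B (V - {j}))"
    using A BV by (intro emeasure_eq_AE)
  also have "\<dots> = ennreal (surv j n i)"
    using emeasure_srw_stay[of "V - {j}" E i n] finite_V stay[OF i] by simp
  finally show ?thesis .
qed

lemma hitting_time_eq_suminf:
  assumes "\<And>u. u \<in> V \<Longrightarrow> nb u \<noteq> {}" and "i \<in> V"
  shows "hitting_time E i j = (\<Sum>n. ennreal (surv j n i))"
proof -
  have [measurable]: "{X. \<forall>m. 0 < m \<and> m \<le> n \<longrightarrow> X m \<noteq> j} \<in> sets (srw E i)" for n
  proof -
    have "{X \<in> space (srw E i). \<forall>m. 0 < m \<and> m \<le> n \<longrightarrow> X m \<noteq> j} \<in> sets (srw E i)"
      by measurable
    then show ?thesis by simp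
  qed
  have "hitting_time E i j =
      (\<Sum>n. \<integral>\<^sup>+ X. indicator {X. \<forall>m. 0 < m \<and> m \<le> n \<longrightarrow> X m \<noteq> j} X \<partial>srw E i)"
    unfolding hitting_time_def hit_eq_suminf by (rule nn_integral_suminf) measurable
  then show ?thesis
    using emeasure_surv[OF assms] by simp
qed

text \<open>Finiteness of the hitting times is derived here. Partial sums of survival probabilities
  satisfy the hypotheses of \<open>potential_upper\<close> with a bound uniform in their length,
  hence they converge, and the limit satisfies the exact equation that
  \<open>potential_lower\<close> requires.\<close>

lemma target_time_bounds:
  assumes cut: "\<And>S. S \<subseteq> V \<Longrightarrow> 2 * card S \<le> card V \<Longrightarrow>
      \<alpha> * real (card S) \<le> (\<Sum>u\<in>S. real (card (nb u - S)))"
    and \<alpha>: "0 < \<alpha>" and \<Delta>: "\<And>u. u \<in> V \<Longrightarrow> deg u \<le> \<Delta>"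
    and j: "j \<in> V" and V2: "2 \<le> card V"
  shows "\<exists>H. target_time V E j = ennreal H \<and>
    1 + (vol - deg j)\<^sup>2 / (vol * deg j) \<le> H \<and>
    H \<le> 1 + vol / deg j * (1 + sqrt ((\<Delta> * deg j / vol + 1) * (2 * \<Delta> / \<alpha>\<^sup>2)))\<^sup>2"
proof -
  have deg0: "0 < deg u" if "u \<in> V" for u
  proof -
    have "\<alpha> \<le> real (card (nb u - {u}))"
      using cut[of "{u}"] that V2 by simp
    then show ?thesis
      using \<alpha> nb_irrefl[of u] by (simp add: degree_def)
  qed
  then have ne: "nb u \<noteq> {}" if "u \<in> V" for u
    using that by (fastforce simp: degree_def)
  have vol0: "0 < vol"
    unfolding vol_def using deg0 j finite_V by (intro sum_pos) auto
  define c where "c = (1 + sqrt ((\<Delta> * deg j / vol + 1) * (2 * \<Delta> / \<alpha>\<^sup>2)))\<^sup>2"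
  define K where "K = vol\<^sup>2 / deg j * c"
  \<comment> \<open>\<open>S n i\<close> is the expectation of the hitting time truncated at
    \<open>n\<close>. Below, \<open>F\<close> resets it to 0 at \<open>j\<close>.\<close>
  define S where "S n i = (\<Sum>m<n. surv j m i)" for n i
  define F where "F n i = (if i = j then 0 else S n i)" for n i
  have FS: "(\<Sum>k\<in>nb i. F n k) = (\<Sum>k\<in>nb i - {j}. S n k)" for n i
    by (rule sum.mono_neutral_cong_right) (auto simp: F_def)
  have S_Suc: "S (Suc n) i = 1 + (\<Sum>k\<in>nb i. F n k) / deg i" for n i
  proof -
    have "S (Suc n) i = 1 + (\<Sum>m<n. surv j (Suc m) i)"
      unfolding S_def by (subst sum.lessThan_Suc_shift) simp
    also have "(\<Sum>m<n. surv j (Suc m) i) = (\<Sum>k\<in>nb i - {j}. S n k) / deg i"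
      unfolding S_def by (subst sum.swap) (simp add: sum_divide_distrib)
    finally show ?thesis by (simp add: FS)
  qed
  have S0: "0 \<le> S n i" for n i
    unfolding S_def by (intro sum_nonneg surv_nonneg)
  have S_mono: "S n i \<le> S (Suc n) i" for n i
    using surv_nonneg by (simp add: S_def)
  have diff: "(\<Sum>v\<in>nb i. f i - f v) = deg i * f i - (\<Sum>v\<in>nb i. f v)" for f :: "'a \<Rightarrow> real" and i
    by (simp add: sum_subtractf degree_def)
  have FK: "(\<Sum>u\<in>V. deg u * F n u) \<le> K" for n
    unfolding K_def c_def
  proof (rule potential_upper[OF cut \<alpha> \<Delta> j deg0[OF j]])
    fix i assume i: "i \<in> V" "i \<noteq> j"
    \<comment> \<open>First-step analysis is an equality for \<open>S (Suc n) i\<close>.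
      Monotonicity in \<open>n\<close> turns it into an inequality about the single index
      \<open>n\<close>.\<close>
    have "S n i \<le> 1 + (\<Sum>k\<in>nb i. F n k) / deg i"
      using S_mono[of n i] S_Suc[of n i] by simp
    then show "(\<Sum>v\<in>nb i. F n i - F n v) \<le> deg i"
      using deg0[OF i(1)] i(2) unfolding diff by (simp add: F_def[of n i] field_simps)
  qed (use S0 in \<open>auto simp: F_def\<close>)
  have sum_S: "(\<Sum>i\<in>V. deg i * S (Suc n) i) = vol + (\<Sum>u\<in>V. deg u * F n u)" for n
  proof -
    have "(\<Sum>i\<in>V. deg i * S (Suc n) i) = (\<Sum>i\<in>V. deg i + (\<Sum>k\<in>nb i. F n k))"
      using deg0 by (intro sum.cong) (auto simp: S_Suc field_simps)
    also have "\<dots> = vol + (\<Sum>u\<in>V. deg u * F n u)"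
      using sum_arcs_swap[of "\<lambda>u v. F n u"] by (simp add: sum.distrib vol_def sum_deg_mult)
    finally show ?thesis .
  qed
  have summable: "summable (\<lambda>n. surv j n i)" if i: "i \<in> V" for i
  proof (rule bounded_imp_summable)
    fix n
    \<comment> \<open>A nonnegative summand is bounded by the total. This covers
      \<open>i = j\<close> too, where \<open>F\<close> carries no information.\<close>
    have "deg i * S (Suc n) i \<le> (\<Sum>i\<in>V. deg i * S (Suc n) i)"
      using i finite_V S0 by (intro member_le_sum) auto
    also have "\<dots> \<le> vol + K" using sum_S FK by simp
    finally show "(\<Sum>m\<le>n. surv j m i) \<le> (vol + K) / deg i"
      using deg0[OF i] by (simp add: S_def lessThan_Suc_atMost field_simps)
  qed (rule surv_nonneg)
  define h where "h i = (\<Sum>n. surv j n i)" for i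
  define f where "f i = (if i = j then 0 else h i)" for i
  have Slim: "(\<lambda>n. S n i) \<longlonglongrightarrow> h i" if "i \<in> V" for i
    unfolding S_def h_def using summable[OF that] by (rule summable_LIMSEQ)
  have Flim: "(\<lambda>n. F n i) \<longlonglongrightarrow> f i" if "i \<in> V" for i
    unfolding F_def f_def using Slim[OF that] by simp
  have h_eq: "h i = 1 + (\<Sum>k\<in>nb i. f k) / deg i" if i: "i \<in> V" for i
  proof (rule LIMSEQ_unique)
    show "(\<lambda>n. S (Suc n) i) \<longlonglongrightarrow> h i"
      using Slim[OF i] by (rule LIMSEQ_Suc)
    show "(\<lambda>n. S (Suc n) i) \<longlonglongrightarrow> 1 + (\<Sum>k\<in>nb i. f k) / deg i"
      unfolding S_Suc using Flim nb_subset deg0[OF i] by (intro tendsto_intros) auto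
  qed
  have fK: "(\<Sum>u\<in>V. deg u * f u) \<le> K"
  proof (rule LIMSEQ_le_const2)
    show "(\<lambda>n. \<Sum>u\<in>V. deg u * F n u) \<longlonglongrightarrow> (\<Sum>u\<in>V. deg u * f u)"
      using Flim by (intro tendsto_intros) auto
  qed (use FK in blast)
  have flow: "(vol - deg j)\<^sup>2 / deg j \<le> (\<Sum>u\<in>V. deg u * f u)"
  proof (rule potential_lower(2)[OF j deg0[OF j]])
    fix i assume i: "i \<in> V" "i \<noteq> j"
    then show "(\<Sum>v\<in>nb i. f i - f v) = deg i"
      using deg0[OF i(1)] h_eq[OF i(1)] unfolding diff by (simp add: f_def[of i] field_simps)
  qed (simp add: f_def)
  \<comment> \<open>\<open>h j\<close> is the mean return time, which \<open>f\<close> replaces by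
    0. Stationarity compensates: the average of \<open>h\<close> is one step more than the average
    of \<open>f\<close>.\<close>
  have sum_h: "(\<Sum>i\<in>V. deg i * h i) = vol + (\<Sum>u\<in>V. deg u * f u)"
  proof -
    have "(\<Sum>i\<in>V. deg i * h i) = (\<Sum>i\<in>V. deg i + (\<Sum>k\<in>nb i. f k))"
      using deg0 by (intro sum.cong) (auto simp: h_eq field_simps)
    also have "\<dots> = vol + (\<Sum>u\<in>V. deg u * f u)"
      using sum_arcs_swap[of "\<lambda>u v. f u"] by (simp add: sum.distrib vol_def sum_deg_mult)
    finally show ?thesis .
  qed
  have h0: "0 \<le> h i" if "i \<in> V" for i
    unfolding h_def using summable[OF that] surv_nonneg by (intro suminf_nonneg)
  define H where "H = (\<Sum>i\<in>V. deg i * h i) / vol"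
  have "target_time V E j = (\<Sum>i\<in>V. ennreal (deg i / vol * h i))"
    unfolding target_time_def
  proof (rule sum.cong)
    fix i assume i: "i \<in> V"
    have "hitting_time E i j = ennreal (h i)"
      unfolding hitting_time_eq_suminf[OF ne i, simplified] h_def
      using surv_nonneg summable[OF i] by (rule suminf_ennreal2)
    moreover have "stationary E i = deg i / vol"
      by (simp add: stationary_def vol_eq)
    ultimately show "ennreal (stationary E i) * hitting_time E i j = ennreal (deg i / vol * h i)"
      using ennreal_mult''[OF h0[OF i], of "deg i / vol"] by (simp only:)
  qed simp
  also have "\<dots> = ennreal H"
    using h0 vol0 by (simp add: sum_ennreal H_def sum_divide_distrib)
  finally have "target_time V E j = ennreal H" .
  moreover have "H = 1 + (\<Sum>u\<in>V. deg u * f u) / vol"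
    using vol0 by (simp add: H_def sum_h add_divide_distrib)
  moreover have "(vol - deg j)\<^sup>2 / (vol * deg j) \<le> (\<Sum>u\<in>V. deg u * f u) / vol"
    using divide_right_mono[OF flow, of vol] vol0 by (simp add: mult.commute)
  moreover have "(\<Sum>u\<in>V. deg u * f u) / vol \<le> vol / deg j * c"
    using divide_right_mono[OF fK, of vol] vol0 by (simp add: K_def power2_eq_square)
  ultimately show ?thesis
    unfolding c_def by (intro exI[of _ H]) auto
qed

end

section \<open>Edge counts in the random graph\<close>

lemma exp_le_quadratic:
  fixes x :: real
  assumes "\<bar>x\<bar> \<le> 1"
  shows "exp x \<le> 1 + x + x\<^sup>2"
proof (cases "0 \<le> x")
  case True
  then show ?thesis using assms by (intro exp_bound) auto
next
  case False
  define y where "y = - x"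
  have y: "0 \<le> y" using False by (simp add: y_def)
  \<comment> \<open>For negative arguments the quadratic lower bound on \<open>exp y\<close> is
    inverted: its product with \<open>1 - y + y\<^sup>2\<close> is still at least 1.\<close>
  have "1 \<le> (1 + y + y\<^sup>2 / 2) * (1 - y + y\<^sup>2)"
  proof -
    have "(1 + y + y\<^sup>2 / 2) * (1 - y + y\<^sup>2) = 1 + (y\<^sup>2 + y ^ 3 + y ^ 4) / 2"
      by (simp add: field_simps power2_eq_square power3_eq_cube power4_eq_xxxx)
    then show ?thesis using y by simp
  qed
  also have "\<dots> \<le> exp y * (1 - y + y\<^sup>2)"
  proof (intro mult_right_mono)
    show "1 + y + y\<^sup>2 / 2 \<le> exp y" using exp_lower_Taylor_quadratic[OF y] .
    show "0 \<le> 1 - y + y\<^sup>2"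
      using assms y by (simp add: y_def)
  qed
  finally have "exp (- y) \<le> 1 - y + y\<^sup>2"
    by (simp add: exp_minus field_simps)
  then show ?thesis by (simp add: y_def)
qed

lemma finite_possible_edges [simp]: "finite (possible_edges N)"
  unfolding possible_edges_def by simp

lemma card_possible_edges: "real (card (possible_edges N)) = real N * (real N - 1) / 2"
  unfolding possible_edges_def using n_subsets[of "{..<N}" 2]
  by (cases N) (simp_all add: choose_two real_of_nat_div algebra_simps)

lemma set_pmf_gnp: "set_pmf (gnp N p) \<subseteq> Pow (possible_edges N)"
  by (auto simp: gnp_def)

lemma finite_set_pmf_gnp: "finite (set_pmf (gnp N p))"
  using set_pmf_gnp by (rule finite_subset) simp

lemma simple_graph_gnp: "E \<in> set_pmf (gnp N p) \<Longrightarrow> simple_graph {..<N} E"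
  using set_pmf_gnp[of N p] by unfold_locales (auto simp: possible_edges_def)

text \<open>The exponential is a product over independent edge indicators, and pairs outside
  \<open>F\<close> contribute the factor 1.\<close>

lemma gnp_mgf:
  assumes F: "F \<subseteq> possible_edges N" and p: "p \<in> {0..1}"
  shows "measure_pmf.expectation (gnp N p) (\<lambda>E. exp (t * real (card (E \<inter> F)))) =
    (1 + p * (exp t - 1)) ^ card F"
proof -
  let ?P = "possible_edges N"
  let ?f = "\<lambda>e b. if e \<in> F \<and> b then exp t else 1 :: real"
  have finF: "finite F" using F finite_possible_edges finite_subset by blast
  have eq: "exp (t * real (card ({e \<in> ?P. f e} \<inter> F))) = (\<Prod>e\<in>?P. ?f e (f e))" for f
  proof -
    have "(\<Prod>e\<in>?P. ?f e (f e)) = (\<Prod>e\<in>?P \<inter> {e. e \<in> F \<and> f e}. exp t)"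
      by (subst prod.If_cases) auto
    also have "?P \<inter> {e. e \<in> F \<and> f e} = {e \<in> ?P. f e} \<inter> F" by auto
    finally show ?thesis by (simp add: exp_of_nat_mult[symmetric] mult.commute)
  qed
  have "measure_pmf.expectation (gnp N p) (\<lambda>E. exp (t * real (card (E \<inter> F)))) =
      measure_pmf.expectation (Pi_pmf ?P False (\<lambda>_. bernoulli_pmf p)) (\<lambda>f. \<Prod>e\<in>?P. ?f e (f e))"
    by (simp add: gnp_def eq)
  also have "\<dots> = (\<Prod>e\<in>?P. measure_pmf.expectation (bernoulli_pmf p) (?f e))"
    by (rule expectation_prod_Pi_pmf) (auto intro!: integrable_measure_pmf_finite)
  also have "\<dots> = (\<Prod>e\<in>?P. if e \<in> F then 1 + p * (exp t - 1) else 1)"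
    using p by (intro prod.cong) (auto simp: algebra_simps)
  also have "\<dots> = (1 + p * (exp t - 1)) ^ card F"
    using F by (simp add: prod.If_cases Int_absorb1 Int_absorb2)
  finally show ?thesis .
qed

text \<open>The sign of \<open>t\<close> selects the tail, so one lemma serves upper and lower
  deviations.\<close>

lemma gnp_exponential_markov:
  assumes F: "F \<subseteq> possible_edges N" and p: "p \<in> {0..1}" and t: "\<bar>t\<bar> \<le> 1"
    and A: "\<And>E. E \<in> A \<Longrightarrow> a \<le> t * real (card (E \<inter> F))"
  shows "measure_pmf.prob (gnp N p) A \<le> exp (p * real (card F) * (t + t\<^sup>2) - a)"
proof -
  have int: "integrable (measure_pmf (gnp N p)) g" for g :: "nat set set \<Rightarrow> real"
    by (rule integrable_measure_pmf_finite[OF finite_set_pmf_gnp])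
  have "measure_pmf.prob (gnp N p) A = measure_pmf.expectation (gnp N p) (indicator A)"
    by simp
  also have "\<dots> \<le> measure_pmf.expectation (gnp N p) (\<lambda>E. exp (- a) * exp (t * real (card (E \<inter> F))))"
    using A by (intro integral_mono int) (auto simp: indicator_def exp_add[symmetric])
  also have "\<dots> = exp (- a) * (1 + p * (exp t - 1)) ^ card F"
    using gnp_mgf[OF F p] by simp
  also have "\<dots> \<le> exp (- a) * exp (p * (t + t\<^sup>2)) ^ card F"
  proof (intro mult_left_mono power_mono)
    have "1 + p * (exp t - 1) \<le> 1 + p * (t + t\<^sup>2)"
      using exp_le_quadratic[OF t] p by (intro add_left_mono mult_left_mono) auto
    also have "\<dots> \<le> exp (p * (t + t\<^sup>2))" by simp
    finally show "1 + p * (exp t - 1) \<le> exp (p * (t + t\<^sup>2))" .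
    \<comment> \<open>The base is a convex combination of 1 and \<open>exp t\<close>, hence
      nonnegative, as monotonicity of powers requires.\<close>
    have "0 \<le> (1 - p) + p * exp t"
      using p by simp
    then show "0 \<le> 1 + p * (exp t - 1)" by (simp add: algebra_simps)
  qed auto
  also have "\<dots> = exp (p * real (card F) * (t + t\<^sup>2) - a)"
    by (simp add: exp_of_nat_mult[symmetric] exp_add[symmetric] algebra_simps)
  finally show ?thesis .
qed

text \<open>In the upper tail the exponent per unit of mean is
  \<open>t\<^sup>2 - \<epsilon> * t\<close>, minimal at \<open>t = \<epsilon> / 2\<close>; the lower
  tail mirrors it. The lower bound \<open>m\<close> on the mean allows later estimates in terms of
  \<open>N * p\<close> alone.\<close>

lemma gnp_chernoff:
  assumes F: "F \<subseteq> possible_edges N" and p: "p \<in> {0..1}" and \<epsilon>: "0 \<le> \<epsilon>" "\<epsilon> \<le> 1"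
    and m: "m \<le> p * real (card F)"
  shows "measure_pmf.prob (gnp N p)
      {E. \<epsilon> * (p * real (card F)) \<le> \<bar>real (card (E \<inter> F)) - p * real (card F)\<bar>} \<le>
    2 * exp (- m * \<epsilon>\<^sup>2 / 4)"
proof -
  define \<mu> where "\<mu> = p * real (card F)"
  let ?U = "{E. (1 + \<epsilon>) * \<mu> \<le> real (card (E \<inter> F))}"
  let ?L = "{E. real (card (E \<inter> F)) \<le> (1 - \<epsilon>) * \<mu>}"
  have "measure_pmf.prob (gnp N p) ?U \<le> exp (p * real (card F) * (\<epsilon> / 2 + (\<epsilon> / 2)\<^sup>2) - \<epsilon> / 2 * ((1 + \<epsilon>) * \<mu>))"
    using \<epsilon> by (intro gnp_exponential_markov[OF F p]) (auto intro!: mult_left_mono)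
  also have "\<dots> = exp (- \<mu> * \<epsilon>\<^sup>2 / 4)"
    by (simp add: \<mu>_def[symmetric] power2_eq_square field_simps)
  finally have U: "measure_pmf.prob (gnp N p) ?U \<le> exp (- \<mu> * \<epsilon>\<^sup>2 / 4)" .
  have "measure_pmf.prob (gnp N p) ?L \<le> exp (p * real (card F) * (- \<epsilon> / 2 + (- \<epsilon> / 2)\<^sup>2) - (- \<epsilon> / 2) * ((1 - \<epsilon>) * \<mu>))"
    using \<epsilon> by (intro gnp_exponential_markov[OF F p]) (auto intro!: mult_left_mono simp: mult.assoc)
  also have "\<dots> = exp (- \<mu> * \<epsilon>\<^sup>2 / 4)"
    by (simp add: \<mu>_def[symmetric] power2_eq_square field_simps)
  finally have L: "measure_pmf.prob (gnp N p) ?L \<le> exp (- \<mu> * \<epsilon>\<^sup>2 / 4)" .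
  have "measure_pmf.prob (gnp N p) {E. \<epsilon> * \<mu> \<le> \<bar>real (card (E \<inter> F)) - \<mu>\<bar>} \<le> measure_pmf.prob (gnp N p) (?U \<union> ?L)"
    by (intro measure_pmf.finite_measure_mono) (auto simp: algebra_simps abs_if split: if_splits)
  also have "\<dots> \<le> measure_pmf.prob (gnp N p) ?U + measure_pmf.prob (gnp N p) ?L"
    by (intro measure_Un_le) auto
  also have "\<dots> \<le> 2 * exp (- \<mu> * \<epsilon>\<^sup>2 / 4)"
    using U L by simp
  also have "\<dots> \<le> 2 * exp (- m * \<epsilon>\<^sup>2 / 4)"
    using m by (simp add: \<mu>_def mult_right_mono)
  finally show ?thesis by (simp add: \<mu>_def)
qed

section \<open>Cuts and the probability of pseudorandomness\<close>

definition cut_edges :: "'a set \<Rightarrow> 'a set \<Rightarrow> 'a set set" where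
  "cut_edges V S = (\<lambda>(u, v). {u, v}) ` (S \<times> (V - S))"

lemma inj_on_cut: "inj_on (\<lambda>(u, v). {u, v}) (S \<times> (V - S))"
  by (auto simp: inj_on_def doubleton_eq_iff)

lemma card_cut_edges: "finite V \<Longrightarrow> S \<subseteq> V \<Longrightarrow> card (cut_edges V S) = card S * (card V - card S)"
  by (simp add: cut_edges_def card_image[OF inj_on_cut] card_cartesian_product card_Diff_subset finite_subset)

lemma cut_edges_possible: "S \<subseteq> {..<N} \<Longrightarrow> cut_edges {..<N} S \<subseteq> possible_edges N"
  by (auto simp: cut_edges_def possible_edges_def card_insert_if)

lemma (in simple_graph) card_Int_cut_edges:
  assumes "S \<subseteq> V"
  shows "card (E \<inter> cut_edges V S) = (\<Sum>u\<in>S. card (nb u - S))"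
proof -
  have "E \<inter> cut_edges V S = (\<lambda>(u, v). {u, v}) ` (SIGMA u:S. nb u - S)"
    using nb_subset by (auto simp: cut_edges_def neighbours_def)
  moreover have "inj_on (\<lambda>(u, v). {u, v}) (SIGMA u:S. nb u - S)"
    by (rule inj_on_subset[OF inj_on_cut[of S V]]) (use nb_subset in auto)
  moreover have "finite S" using assms finite_V finite_subset by blast
  ultimately show ?thesis by (simp add: card_image)
qed

text \<open>Degrees are edge counts of singleton cuts, so the Chernoff bound for cuts covers
  them.\<close>

lemma (in simple_graph) card_Int_cut_edges_singleton:
  assumes "u \<in> V"
  shows "card (E \<inter> cut_edges V {u}) = degree E u"
  using card_Int_cut_edges[of "{u}"] assms nb_irrefl[of u] by (simp add: degree_def)

text \<open>Relative error \<open>\<delta>\<close> is asked only of the degree of \<open>j\<close>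
  and of the number of edges, since the leading term is \<open>vol / deg j\<close>. For the cuts and
  the other degrees, bounds up to constant factors suffice to control the error term.\<close>

definition pseudorandom :: "nat \<Rightarrow> real \<Rightarrow> nat \<Rightarrow> real \<Rightarrow> nat set set \<Rightarrow> bool" where
  "pseudorandom N p j \<delta> E \<longleftrightarrow>
    (\<forall>S\<subseteq>{..<N}. 2 * card S \<le> N \<longrightarrow>
      real N * p / 4 * real (card S) \<le> (\<Sum>u\<in>S. real (card (neighbours E u - S)))) \<and>
    (\<forall>u<N. real (degree E u) \<le> 2 * (real N * p)) \<and>
    \<bar>real (degree E j) - p * (real N - 1)\<bar> \<le> \<delta> * (p * (real N - 1)) \<and>
    \<bar>real (card E) - p * (real N * (real N - 1) / 2)\<bar> \<le> \<delta> * (p * (real N * (real N - 1) / 2))"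

text \<open>A union bound. With \<open>x = exp (- (real N * p) / 32)\<close>, the cut of
  \<open>S\<close> fails with probability at most \<open>2 * x ^ card S\<close>, and summing
  \<open>x ^ card S\<close> over all nonempty \<open>S\<close> gives
  \<open>(1 + x) ^ N - 1\<close>.\<close>

lemma prob_not_pseudorandom:
  assumes p: "p \<in> {0..1}" and N: "2 \<le> N" and j: "j < N" and \<delta>: "0 \<le> \<delta>" "\<delta> \<le> 1"
  shows "measure_pmf.prob (gnp N p) {E. \<not> pseudorandom N p j \<delta> E} \<le>
    2 * ((1 + exp (- (real N * p) / 32)) ^ N - 1) + 2 * real N * exp (- (real N * p) / 8)
      + 4 * exp (- (real N * p) * \<delta>\<^sup>2 / 8)"
proof -
  let ?V = "{..<N}" and ?d = "real N * p" and ?P = "measure_pmf.prob (gnp N p)"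
  define dev where "dev F \<epsilon> =
    {E. \<epsilon> * (p * real (card F)) \<le> \<bar>real (card (E \<inter> F)) - p * real (card F)\<bar>}" for F :: "nat set set" and \<epsilon>
  \<comment> \<open>The empty set is left out: its cut has mean 0, so its deviation event would be
    everything. Its cut condition is trivial.\<close>
  define Cuts where "Cuts = {S. S \<subseteq> ?V \<and> S \<noteq> {} \<and> 2 * card S \<le> N}"
  define x where "x = exp (- ?d / 32)"
  have N1: "real N / 2 \<le> real N - 1" using N by simp
  have p0: "0 \<le> p" using p by simp
  have half: "?d / 2 \<le> p * (real N - 1)"
    using mult_left_mono[OF N1 p0] by (simp add: mult.commute)
  have fin: "finite Cuts" by (simp add: Cuts_def)
  have cut_card: "real (card (cut_edges ?V S)) = real (card S) * (real N - real (card S))" if "S \<subseteq> ?V" for S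
    using card_cut_edges[of ?V S] card_mono[of ?V S] that by (simp add: of_nat_diff)
  have sing: "real (card (cut_edges ?V {u})) = real N - 1" if "u < N" for u
    using cut_card[of "{u}"] that by simp
  have cut_mean: "?d / 2 * real (card S) \<le> p * real (card (cut_edges ?V S))" if "S \<in> Cuts" for S
  proof -
    have "real (2 * card S) \<le> real N" using that unfolding Cuts_def by (subst of_nat_le_iff) blast
    then have "p * (real (card S) * (real N / 2)) \<le> p * (real (card S) * (real N - real (card S)))"
      using p0 by (intro mult_left_mono) auto
    then show ?thesis using that by (simp add: Cuts_def cut_card mult_ac)
  qed
  have cuts: "?P (dev (cut_edges ?V S) (1 / 2)) \<le> 2 * x ^ card S" if S: "S \<in> Cuts" for S
  proof -
    \<comment> \<open>The mean is at least \<open>?d / 2\<close> per vertex of \<open>S\<close>, and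
      relative deviation 1/2 contributes 1/16, whence the 32 in \<open>x\<close>.\<close>
    have "?P (dev (cut_edges ?V S) (1 / 2)) \<le> 2 * exp (- (?d / 2 * real (card S)) * (1 / 2)\<^sup>2 / 4)"
      unfolding dev_def using S cut_mean[OF S] p
      by (intro gnp_chernoff cut_edges_possible) (auto simp: Cuts_def)
    also have "\<dots> = 2 * x ^ card S"
      by (simp add: x_def exp_of_nat_mult[symmetric] power2_eq_square mult_ac)
    finally show ?thesis .
  qed
  have degs: "?P (dev (cut_edges ?V {u}) \<epsilon>) \<le> 2 * exp (- ?d * \<epsilon>\<^sup>2 / 8)"
    if "u < N" "0 \<le> \<epsilon>" "\<epsilon> \<le> 1" for u \<epsilon>
  proof -
    have "?P (dev (cut_edges ?V {u}) \<epsilon>) \<le> 2 * exp (- (?d / 2) * \<epsilon>\<^sup>2 / 4)"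
      unfolding dev_def using that p half sing
      by (intro gnp_chernoff cut_edges_possible) auto
    then show ?thesis by simp
  qed
  have all: "?P (dev (possible_edges N) \<delta>) \<le> 2 * exp (- ?d * \<delta>\<^sup>2 / 8)"
  proof -
    have "?d / 2 \<le> p * (real N * (real N - 1) / 2)"
    proof -
      have "real N - 1 \<le> real N * (real N - 1) / 2"
        using N mult_right_mono[of 2 "real N" "real N - 1"] by simp
      then show ?thesis using half mult_left_mono[OF _ p0] by (meson order_trans)
    qed
    then have "?P (dev (possible_edges N) \<delta>) \<le> 2 * exp (- (?d / 2) * \<delta>\<^sup>2 / 4)"
      unfolding dev_def using \<delta> p by (intro gnp_chernoff) (auto simp: card_possible_edges)
    then show ?thesis by simp
  qed
  \<comment> \<open>The restriction to the support provides a simple graph on \<open>?V\<close>, for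
    which cut counts agree with neighbour counts.\<close>
  have sub: "{E. \<not> pseudorandom N p j \<delta> E} \<inter> set_pmf (gnp N p) \<subseteq>
      (\<Union>S\<in>Cuts. dev (cut_edges ?V S) (1 / 2)) \<union> (\<Union>u<N. dev (cut_edges ?V {u}) 1) \<union>
      (dev (cut_edges ?V {j}) \<delta> \<union> dev (possible_edges N) \<delta>)" (is "_ \<subseteq> ?R")
  proof
    fix E assume E: "E \<in> {E. \<not> pseudorandom N p j \<delta> E} \<inter> set_pmf (gnp N p)"
    then interpret simple_graph ?V E using simple_graph_gnp by blast
    show "E \<in> ?R"
    proof (rule ccontr)
      assume nR: "E \<notin> ?R"
      have "?d / 4 * real (card S) \<le> (\<Sum>u\<in>S. real (card (nb u - S)))"
        if "S \<subseteq> ?V" "2 * card S \<le> N" for S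
      proof (cases "S = {}")
        case False
        then have S: "S \<in> Cuts" using that by (simp add: Cuts_def)
        then have "E \<notin> dev (cut_edges ?V S) (1 / 2)" using nR by blast
        then have "p * real (card (cut_edges ?V S)) / 2 \<le> real (card (E \<inter> cut_edges ?V S))"
          by (auto simp: dev_def abs_if split: if_splits)
        then show ?thesis
          using cut_mean[OF S] by (simp add: card_Int_cut_edges[OF that(1)])
      qed simp
      moreover have "deg u \<le> 2 * ?d" if "u < N" for u
      proof -
        have "E \<notin> dev (cut_edges ?V {u}) 1" using nR that by blast
        then have "deg u \<le> 2 * (p * (real N - 1))"
          using that by (simp add: dev_def sing card_Int_cut_edges_singleton)
        also have "\<dots> \<le> 2 * ?d" using p0 by (simp add: algebra_simps)
        finally show ?thesis .
      qed
      moreover have "E \<notin> dev (cut_edges ?V {j}) \<delta>" using nR by blast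
      then have "\<bar>deg j - p * (real N - 1)\<bar> \<le> \<delta> * (p * (real N - 1))"
        using j by (simp add: dev_def sing card_Int_cut_edges_singleton)
      moreover have "E \<notin> dev (possible_edges N) \<delta>" using nR by blast
      moreover have "E \<inter> possible_edges N = E" using E set_pmf_gnp by blast
      ultimately have "pseudorandom N p j \<delta> E"
        by (auto simp: pseudorandom_def dev_def card_possible_edges)
      then show False using E by simp
    qed
  qed
  have "?P {E. \<not> pseudorandom N p j \<delta> E} \<le> ?P ?R"
    using sub by (subst measure_Int_set_pmf[symmetric]) (auto intro!: measure_pmf.finite_measure_mono)
  also have "\<dots> \<le> ?P (\<Union>S\<in>Cuts. dev (cut_edges ?V S) (1 / 2)) + ?P (\<Union>u<N. dev (cut_edges ?V {u}) 1) +
      (?P (dev (cut_edges ?V {j}) \<delta>) + ?P (dev (possible_edges N) \<delta>))"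
    by (intro order_trans[OF measure_Un_le] add_mono) auto
  also have "\<dots> \<le> (\<Sum>S\<in>Cuts. 2 * x ^ card S) + (\<Sum>u<N. 2 * exp (- ?d / 8)) +
      (2 * exp (- ?d * \<delta>\<^sup>2 / 8) + 2 * exp (- ?d * \<delta>\<^sup>2 / 8))"
  proof (intro add_mono)
    show "?P (\<Union>S\<in>Cuts. dev (cut_edges ?V S) (1 / 2)) \<le> (\<Sum>S\<in>Cuts. 2 * x ^ card S)"
      by (intro order_trans[OF measure_pmf.finite_measure_subadditive_finite] sum_mono cuts fin) auto
    show "?P (\<Union>u<N. dev (cut_edges ?V {u}) 1) \<le> (\<Sum>u<N. 2 * exp (- ?d / 8))"
      using degs[of _ 1]
      by (intro order_trans[OF measure_pmf.finite_measure_subadditive_finite] sum_mono) auto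
  qed (use degs j \<delta> all in auto)
  also have "(\<Sum>S\<in>Cuts. 2 * x ^ card S) \<le> 2 * ((1 + x) ^ N - 1)"
  proof -
    have "(\<Sum>S\<in>Cuts. x ^ card S) \<le> (\<Sum>S\<in>Pow ?V - {{}}. x ^ card S)"
      by (intro sum_mono2) (auto simp: Cuts_def x_def)
    also have "\<dots> = (\<Sum>S\<in>Pow ?V. x ^ card S) - 1"
      by (simp add: sum_diff1)
    also have "(\<Sum>S\<in>Pow ?V. x ^ card S) = (x + 1) ^ N"
      using prod_add[of ?V "\<lambda>_. x" "\<lambda>_. 1"] by simp
    finally show ?thesis by (simp add: sum_distrib_left[symmetric] add.commute)
  qed
  finally show ?thesis by (simp add: x_def)
qed

section \<open>The target time in the random graph\<close>

lemma pseudorandom_target_time: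
  assumes G: "simple_graph {..<N} E" and pr: "pseudorandom N p j \<delta> E"
    and p: "0 < p" and N: "4 \<le> N" and j: "j < N" and \<delta>: "0 \<le> \<delta>" "\<delta> \<le> 1 / 2"
  shows "graph_connected {..<N} E"
    and "\<exists>H. target_time {..<N} E j = ennreal H \<and>
      (1 - \<delta>) / (1 + \<delta>) * (1 - 3 / real N)\<^sup>2 \<le> H / real N \<and>
      H / real N \<le> 1 / real N + (1 + \<delta>) / (1 - \<delta>) * (1 + 24 / sqrt (real N * p))\<^sup>2"
proof -
  interpret simple_graph "{..<N}" E by (rule G)
  let ?d = "real N * p"
  have d: "0 < ?d" using p N by simp
  have cut: "?d / 4 * real (card S) \<le> (\<Sum>u\<in>S. real (card (nb u - S)))"
    if "S \<subseteq> {..<N}" "2 * card S \<le> card {..<N}" for S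
    using pr that unfolding pseudorandom_def by simp
  show "graph_connected {..<N} E"
    using connected_if_cut[OF cut] d by simp
  define m where "m = p * (real N - 1)"
  have m: "0 < m" using p N by (simp add: m_def)
  have "\<bar>deg j - m\<bar> \<le> \<delta> * m"
    using pr by (simp add: pseudorandom_def m_def)
  then have degj: "(1 - \<delta>) * m \<le> deg j" "deg j \<le> (1 + \<delta>) * m"
    by (auto simp: algebra_simps abs_le_iff)
  have "\<bar>real (card E) - real N * m / 2\<bar> \<le> \<delta> * (real N * m / 2)"
    using pr by (simp add: pseudorandom_def m_def mult_ac)
  then have "\<bar>2 * real (card E) - real N * m\<bar> \<le> \<delta> * (real N * m)"
    by linarith
  then have vol: "(1 - \<delta>) * (real N * m) \<le> vol" "vol \<le> (1 + \<delta>) * (real N * m)"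
    unfolding vol_eq by (auto simp: algebra_simps abs_le_iff)
  have \<delta>m: "0 < (1 - \<delta>) * m" using \<delta> m by simp
  have degj0: "0 < deg j" using degj(1) \<delta>m by linarith
  have "0 < (1 - \<delta>) * (real N * m)" using \<delta> m N by simp
  then have vol0: "0 < vol" using vol(1) by linarith
  have ratio_le: "vol / deg j \<le> real N * ((1 + \<delta>) / (1 - \<delta>))"
  proof -
    have "vol / deg j \<le> ((1 + \<delta>) * (real N * m)) / ((1 - \<delta>) * m)"
      using vol degj \<delta>m vol0 by (intro frac_le) auto
    then show ?thesis using m by (simp add: mult_ac)
  qed
  have ratio_ge: "real N * ((1 - \<delta>) / (1 + \<delta>)) \<le> vol / deg j"
  proof -
    have "((1 - \<delta>) * (real N * m)) / ((1 + \<delta>) * m) \<le> vol / deg j"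
      using vol degj degj0 vol0 by (intro frac_le) auto
    then show ?thesis using m by (simp add: mult_ac)
  qed
  \<comment> \<open>The constant 3 is the value of \<open>(1 + \<delta>) / (1 - \<delta>)\<close> at
    \<open>\<delta> = 1 / 2\<close>.\<close>
  have inv: "deg j / vol \<le> 3 / real N"
  proof -
    have "deg j / vol \<le> ((1 + \<delta>) * m) / ((1 - \<delta>) * (real N * m))"
      using vol degj \<delta>m \<open>0 < (1 - \<delta>) * (real N * m)\<close> by (intro frac_le) auto
    also have "\<dots> = (1 + \<delta>) / (1 - \<delta>) / real N" using m by (simp add: mult_ac)
    also have "\<dots> \<le> 3 / real N"
      using \<delta> by (intro divide_right_mono) (auto simp: divide_le_eq)
    finally show ?thesis .
  qed
  obtain H where H: "target_time {..<N} E j = ennreal H"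
    "1 + (vol - deg j)\<^sup>2 / (vol * deg j) \<le> H"
    "H \<le> 1 + vol / deg j *
      (1 + sqrt ((2 * ?d * deg j / vol + 1) * (2 * (2 * ?d) / (?d / 4)\<^sup>2)))\<^sup>2"
    using target_time_bounds[OF cut, of "2 * ?d" j] d N j pr
    by (auto simp: pseudorandom_def)
  \<comment> \<open>\<open>N \<ge> 4\<close> keeps \<open>1 - 3 / real N\<close> nonnegative, so
    that squaring is monotone.\<close>
  have "real N * ((1 - \<delta>) / (1 + \<delta>)) * (1 - 3 / real N)\<^sup>2 \<le> vol / deg j * (1 - deg j / vol)\<^sup>2"
  proof (intro mult_mono power_mono ratio_ge)
    show "1 - 3 / real N \<le> 1 - deg j / vol" using inv by simp
  qed (use N degj0 vol0 in auto)
  also have "\<dots> = (vol - deg j)\<^sup>2 / (vol * deg j)"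
    using vol0 degj0 by (simp add: power2_eq_square divide_simps)
  also have "\<dots> \<le> H" using H(2) by simp
  finally have lower: "(1 - \<delta>) / (1 + \<delta>) * (1 - 3 / real N)\<^sup>2 \<le> H / real N"
    using N by (simp add: field_simps)
  \<comment> \<open>The crude bound \<open>deg j \<le> real N\<close> is enough here:
    \<open>vol\<close> is at least \<open>real N * m / 2\<close> and \<open>?d\<close> is at most
    \<open>2 * m\<close>.\<close>
  have "2 * ?d * deg j / vol \<le> 8"
  proof -
    have "deg j \<le> real N"
      using card_mono[OF _ nb_subset[of j]] by (simp add: degree_def)
    then have "2 * ?d * deg j \<le> 2 * ?d * real N" using d by (intro mult_left_mono) auto
    also have "\<dots> \<le> 8 * ((1 / 2) * (real N * m))"
    proof -
      have "real N * p \<le> 2 * m" using N p by (simp add: m_def algebra_simps)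
      from mult_left_mono[OF this, of "2 * real N"] show ?thesis by (simp add: mult_ac)
    qed
    also have "\<dots> \<le> 8 * ((1 - \<delta>) * (real N * m))"
      using \<delta> m by (intro mult_left_mono mult_right_mono) auto
    also have "\<dots> \<le> 8 * vol" using vol(1) by simp
    finally show ?thesis using vol0 by (simp add: divide_le_eq)
  qed
  \<comment> \<open>With \<open>\<alpha> = ?d / 4\<close> and \<open>\<Delta> = 2 * ?d\<close> the
    second factor is \<open>64 / ?d\<close>, and 9 times 64 is the square of 24.\<close>
  then have "(2 * ?d * deg j / vol + 1) * (2 * (2 * ?d) / (?d / 4)\<^sup>2) \<le> 9 * (2 * (2 * ?d) / (?d / 4)\<^sup>2)"
    using d by (intro mult_right_mono) auto
  also have "\<dots> = 24\<^sup>2 / ?d" using d by (simp add: power2_eq_square field_simps)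
  finally have "sqrt ((2 * ?d * deg j / vol + 1) * (2 * (2 * ?d) / (?d / 4)\<^sup>2)) \<le> sqrt (24\<^sup>2 / ?d)"
    by (rule real_sqrt_le_mono)
  also have "\<dots> = 24 / sqrt ?d" by (simp only: real_sqrt_divide real_sqrt_abs abs_numeral)
  finally have "H \<le> 1 + real N * ((1 + \<delta>) / (1 - \<delta>)) * (1 + 24 / sqrt ?d)\<^sup>2"
    using d vol0 degj0 \<delta>
    by (intro order_trans[OF H(3)] add_left_mono mult_mono power_mono ratio_le) auto
  then have "H / real N \<le> 1 / real N + (1 + \<delta>) / (1 - \<delta>) * (1 + 24 / sqrt ?d)\<^sup>2"
    using N divide_right_mono[of H _ "real N"] by (fastforce simp: add_divide_distrib)
  with H(1) lower show "\<exists>H. target_time {..<N} E j = ennreal H \<and>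
      (1 - \<delta>) / (1 + \<delta>) * (1 - 3 / real N)\<^sup>2 \<le> H / real N \<and>
      H / real N \<le> 1 / real N + (1 + \<delta>) / (1 - \<delta>) * (1 + 24 / sqrt ?d)\<^sup>2"
    by blast
qed

lemma gnp_target_time:
  fixes p :: "nat \<Rightarrow> real" and j :: "nat \<Rightarrow> nat"
  assumes p: "\<And>N. 0 \<le> p N \<and> p N \<le> 1" and j: "\<And>N. 1 \<le> N \<Longrightarrow> j N < N"
    and big: "eventually (\<lambda>N. (ln (real N))\<^sup>2 \<le> real N * p N) sequentially"
  shows "\<exists>\<epsilon> :: nat \<Rightarrow> real. \<epsilon> \<longlonglongrightarrow> 0 \<and>
    aas p (\<lambda>N E. graph_connected {..<N} E \<and> target_time {..<N} E (j N) < \<infinity> \<and>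
      \<bar>enn2real (target_time {..<N} E (j N)) / real N - 1\<bar> \<le> \<epsilon> N)"
proof -
  define d where "d N = real N * p N" for N
  \<comment> \<open>The fourth root makes \<open>\<delta>\<close> tend to 0 while
    \<open>d N * (\<delta> N)\<^sup>2 = sqrt (d N)\<close> still tends to infinity, as the Chernoff
    bound demands.\<close>
  define \<delta> where "\<delta> N = 1 / sqrt (sqrt (d N))" for N
  define L where "L N = (1 - \<delta> N) / (1 + \<delta> N) * (1 - 3 / real N)\<^sup>2" for N
  define U where "U N = 1 / real N + (1 + \<delta> N) / (1 - \<delta> N) * (1 + 24 / sqrt (d N))\<^sup>2" for N
  define \<epsilon> where "\<epsilon> N = \<bar>L N - 1\<bar> + \<bar>U N - 1\<bar>" for N
  \<comment> \<open>A majorant of the bound in \<open>prob_not_pseudorandom\<close>: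
    \<open>1 + x \<le> exp x\<close> handles the power, and each factor \<open>real N\<close> moves
    into the exponent as \<open>ln (real N)\<close>.\<close>
  define err where "err N = 2 * (exp (exp (ln (real N) - d N / 32)) - 1) +
    2 * exp (ln (real N) - d N / 8) + 4 * exp (- sqrt (d N) / 8)" for N
  have ln_lim: "filterlim (\<lambda>N. (ln (real N))\<^sup>2) at_top sequentially" by real_asymp
  have d_lim: "filterlim d at_top sequentially"
    using filterlim_at_top_mono[OF ln_lim] big by (simp add: d_def)
  have \<delta>_lim: "\<delta> \<longlonglongrightarrow> 0"
  proof -
    have "((\<lambda>x :: real. 1 / sqrt (sqrt x)) \<longlongrightarrow> 0) at_top" by real_asymp
    from filterlim_compose[OF this d_lim] show ?thesis by (simp add: \<delta>_def[abs_def])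
  qed
  have d_inv: "(\<lambda>N. 24 / sqrt (d N)) \<longlonglongrightarrow> 0"
  proof -
    have "((\<lambda>x :: real. 24 / sqrt x) \<longlongrightarrow> 0) at_top" by real_asymp
    from filterlim_compose[OF this d_lim] show ?thesis .
  qed
  have inv: "(\<lambda>N. 1 / real N) \<longlonglongrightarrow> 0" "(\<lambda>N. 3 / real N) \<longlonglongrightarrow> 0" by real_asymp+
  have "L \<longlonglongrightarrow> (1 - 0) / (1 + 0) * (1 - 0)\<^sup>2"
    unfolding L_def by (intro tendsto_intros \<delta>_lim inv) auto
  moreover have "U \<longlonglongrightarrow> 0 + (1 + 0) / (1 - 0) * (1 + 0)\<^sup>2"
    unfolding U_def by (intro tendsto_intros \<delta>_lim inv d_inv) auto
  ultimately have "\<epsilon> \<longlonglongrightarrow> \<bar>1 - 1\<bar> + \<bar>1 - 1\<bar>"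
    unfolding \<epsilon>_def by (intro tendsto_intros) auto
  then have \<epsilon>_lim: "\<epsilon> \<longlonglongrightarrow> 0" by simp
  have err_lim: "err \<longlonglongrightarrow> 0"
  proof -
    \<comment> \<open>This is where \<open>d N\<close> must outgrow \<open>ln (real N)\<close>: the
      square of the logarithm beats the logarithm for every constant \<open>c\<close>.\<close>
    have small: "(\<lambda>N. exp (ln (real N) - d N / c)) \<longlonglongrightarrow> 0" if "0 < c" for c
    proof (rule tendsto_sandwich[OF _ _ tendsto_const])
      show "(\<lambda>N. exp (ln (real N) - (ln (real N))\<^sup>2 / c)) \<longlonglongrightarrow> 0"
        using that by real_asymp
      show "eventually (\<lambda>N. exp (ln (real N) - d N / c) \<le> exp (ln (real N) - (ln (real N))\<^sup>2 / c)) sequentially"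
        using big by eventually_elim (use that in \<open>simp add: d_def divide_right_mono\<close>)
    qed simp
    have "((\<lambda>x :: real. exp (- sqrt x / 8)) \<longlongrightarrow> 0) at_top" by real_asymp
    from filterlim_compose[OF this d_lim] have "(\<lambda>N. exp (- sqrt (d N) / 8)) \<longlonglongrightarrow> 0" .
    then have "err \<longlonglongrightarrow> 2 * (exp 0 - 1) + 2 * 0 + 4 * 0"
      unfolding err_def by (intro tendsto_intros small) auto
    then show ?thesis by simp
  qed
  let ?A = "\<lambda>N. {E. graph_connected {..<N} E \<and> target_time {..<N} E (j N) < \<infinity> \<and>
      \<bar>enn2real (target_time {..<N} E (j N)) / real N - 1\<bar> \<le> \<epsilon> N}"
  have prob: "eventually (\<lambda>N. 1 - err N \<le> measure_pmf.prob (gnp N (p N)) (?A N)) sequentially"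
  proof -
    have "eventually (\<lambda>N. 1 \<le> d N) sequentially"
      using d_lim by (simp add: filterlim_at_top)
    moreover have "eventually (\<lambda>N. \<delta> N < 1 / 2) sequentially"
      using \<delta>_lim by (rule order_tendstoD) simp
    ultimately show ?thesis
      using eventually_ge_at_top[of 4]
    proof eventually_elim
      case (elim N)
      have N: "4 \<le> N" and d: "1 \<le> d N" and \<delta>: "0 \<le> \<delta> N" "\<delta> N \<le> 1 / 2"
        using elim by (auto simp: \<delta>_def)
      have pN: "0 < p N" using d p[of N] by (cases "p N = 0") (auto simp: d_def)
      have jN: "j N < N" using j N by simp
      let ?P = "measure_pmf.prob (gnp N (p N))"
      let ?B = "{E. \<not> pseudorandom N (p N) (j N) (\<delta> N) E}"
      have "?P ?B \<le> 2 * ((1 + exp (- d N / 32)) ^ N - 1) + 2 * real N * exp (- d N / 8)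
          + 4 * exp (- d N * (\<delta> N)\<^sup>2 / 8)"
        using prob_not_pseudorandom[of "p N" N "j N" "\<delta> N"] p N jN \<delta> by (simp add: d_def)
      also have "\<dots> \<le> err N"
      proof -
        have exp_eq: "real N * exp (- d N / c) = exp (ln (real N) - d N / c)" for c
          using N exp_add[of "ln (real N)" "- d N / c"] by simp
        have "(1 + exp (- d N / 32)) ^ N \<le> exp (exp (- d N / 32)) ^ N"
          by (intro power_mono) auto
        also have "\<dots> = exp (exp (ln (real N) - d N / 32))"
          by (simp only: exp_of_nat_mult[symmetric] exp_eq)
        finally have "(1 + exp (- d N / 32)) ^ N \<le> exp (exp (ln (real N) - d N / 32))" .
        moreover have "real N * exp (- d N / 8) = exp (ln (real N) - d N / 8)"
          by (rule exp_eq)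
        moreover have "d N * (\<delta> N)\<^sup>2 = sqrt (d N)"
          using d by (simp add: \<delta>_def power_divide real_div_sqrt)
        ultimately show ?thesis
          unfolding err_def by simp
      qed
      finally have "1 - err N \<le> ?P (- ?B)"
        using measure_pmf.prob_compl[of ?B "gnp N (p N)"] by (simp add: Compl_eq_Diff_UNIV)
      also have "\<dots> = ?P (- ?B \<inter> set_pmf (gnp N (p N)))"
        by (rule measure_Int_set_pmf[symmetric])
      also have "\<dots> \<le> ?P (?A N)"
      proof (intro measure_pmf.finite_measure_mono subsetI)
        fix E assume "E \<in> - ?B \<inter> set_pmf (gnp N (p N))"
        then have E: "simple_graph {..<N} E" "pseudorandom N (p N) (j N) (\<delta> N) E"
          using simple_graph_gnp by auto
        note * = pseudorandom_target_time[OF E pN N jN \<delta>]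
        obtain H where H: "target_time {..<N} E (j N) = ennreal H" "L N \<le> H / real N" "H / real N \<le> U N"
          using *(2) by (auto simp: L_def U_def d_def)
        have "0 \<le> L N" using \<delta> by (simp add: L_def)
        then have "0 \<le> H / real N" using H(2) by linarith
        then have "0 \<le> H" using N by (simp add: zero_le_divide_iff)
        moreover have "\<bar>H / real N - 1\<bar> \<le> \<epsilon> N"
          using H(2,3) by (simp add: \<epsilon>_def abs_if)
        ultimately show "E \<in> ?A N"
          using H(1) *(1) by simp
      qed simp
      finally show ?case .
    qed
  qed
  have "(\<lambda>N. measure_pmf.prob (gnp N (p N)) (?A N)) \<longlonglongrightarrow> 1"
  proof (rule tendsto_sandwich[OF prob _ _ tendsto_const])
    show "(\<lambda>N. 1 - err N) \<longlonglongrightarrow> 1"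
      using tendsto_diff[OF tendsto_const[of 1] err_lim] by simp
  qed simp
  with \<epsilon>_lim show ?thesis
    unfolding aas_def by blast
qed

text \<open>\<open>enn2real\<close> sends infinity to 0, so finiteness of the target time is a
  separate conjunct. A sequence \<open>j\<close> expresses that the vertex may depend on
  \<open>N\<close>.\<close>

theorem theorem2p2:
  fixes a\<^sub>0 b\<^sub>0 :: real and \<xi> :: "nat \<Rightarrow> real"
  assumes "a\<^sub>0 > 0" and "b\<^sub>0 \<ge> 10"
    and "eventually (\<lambda>N. 1 + a\<^sub>0 \<le> \<xi> N \<and> \<xi> N \<le> b\<^sub>0 * ln (ln (real N))) sequentially"
  shows "\<exists>C>0. \<forall>p :: nat \<Rightarrow> real.
    (\<forall>N. 0 \<le> p N \<and> p N \<le> 1) \<longrightarrow>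
    eventually (\<lambda>N. p N > 0) sequentially \<longrightarrow>
    (\<lambda>N. ln (real N) powr (2 * C * \<xi> N) / (real N * p N)) \<longlonglongrightarrow> 0 \<longrightarrow>
    (\<forall>j :: nat \<Rightarrow> nat. (\<forall>N\<ge>1. j N < N) \<longrightarrow>
      (\<exists>\<epsilon> :: nat \<Rightarrow> real. \<epsilon> \<longlonglongrightarrow> 0 \<and>
        aas p (\<lambda>N E.
          graph_connected {..<N} E \<and>
          target_time {..<N} E (j N) < \<infinity> \<and>
          \<bar>enn2real (target_time {..<N} E (j N)) / real N - 1\<bar> \<le> \<epsilon> N)))"
\<comment> \<open>The witness \<open>C = 1\<close> works because \<open>\<xi> N\<close> is
  eventually at least 1, which makes the exponent at least 2.\<close>
proof (intro exI[of _ 1] conjI allI impI)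
  fix p :: "nat \<Rightarrow> real" and j :: "nat \<Rightarrow> nat"
  assume p: "\<forall>N. 0 \<le> p N \<and> p N \<le> 1" and pos: "eventually (\<lambda>N. p N > 0) sequentially"
    and lim: "(\<lambda>N. ln (real N) powr (2 * 1 * \<xi> N) / (real N * p N)) \<longlonglongrightarrow> 0"
    and j: "\<forall>N\<ge>1. j N < N"
  have "eventually (\<lambda>N. ln (real N) powr (2 * 1 * \<xi> N) / (real N * p N) < 1) sequentially"
    using lim by (rule order_tendstoD) simp
  moreover have "eventually (\<lambda>N. 1 \<le> ln (real N)) sequentially" by real_asymp
  ultimately have "eventually (\<lambda>N. (ln (real N))\<^sup>2 \<le> real N * p N) sequentially"
    using assms(3) pos eventually_gt_at_top[of 0]
  proof eventually_elim
    case (elim N)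
    have "(ln (real N))\<^sup>2 = ln (real N) powr 2"
      using elim by (simp add: powr_numeral)
    also have "\<dots> \<le> ln (real N) powr (2 * 1 * \<xi> N)"
      using elim assms(1) by (intro powr_mono) auto
    \<comment> \<open>Clearing the denominator uses \<open>pos\<close>: at \<open>p N = 0\<close>
      the quotient would be 0 by convention and carry no information.\<close>
    also have "\<dots> \<le> real N * p N"
      using elim by (simp add: divide_less_eq)
    finally show ?case .
  qed
  then show "\<exists>\<epsilon> :: nat \<Rightarrow> real. \<epsilon> \<longlonglongrightarrow> 0 \<and>
      aas p (\<lambda>N E. graph_connected {..<N} E \<and> target_time {..<N} E (j N) < \<infinity> \<and>
        \<bar>enn2real (target_time {..<N} E (j N)) / real N - 1\<bar> \<le> \<epsilon> N)"
    using p j by (intro gnp_target_time) auto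
qed simp

end
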